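(* Let $A$ be a finite set and $\mathcal{B}=\mathcal{L}(\mathcal{H})$ for a finite-dimensional Hilbert space $\mathcal{H}$. There is a one-to-one affine correspondence between (1) cq-channels $W:A^{\mathbb{Z}}\times\mathcal{B}^{\mathbb{Z}}\to\mathbb{C}$, (2) linear, positive, unital maps $K:\mathcal{B}^{\mathbb{Z}}\to B(A^{\mathbb{Z}},\Sigma_c)$, and (3) linear, positive, unital maps $E:B(A^{\mathbb{Z}},\Sigma_c)\otimes\mathcal{B}^{\mathbb{Z}}\to B(A^{\mathbb{Z}},\Sigma_c)$ satisfying $E(f\otimes b)=f\,E(\mathbf{1}\otimes b)$ for all $f\in B(A^{\mathbb{Z}},\Sigma_c)$, $b\in\mathcal{B}^{\mathbb{Z}}$. The correspondences are given by $(K(b))(x)=W(x,b)$ and $E=\mathrm{Copy}\circ(\mathrm{id}_{B(A^{\mathbb{Z}},\Sigma_c)}\otimes K)$, i.e. $E(f\otimes b)=fK(b)$, where $\mathrm{Copy}:B(A^{\mathbb{Z}},\Sigma_c)\otimes B(A^{\mathbb{Z}},\Sigma_c)\cong B(A^{\mathbb{Z}}\times A^{\mathbb{Z}},\Sigma_c\times\Sigma_c)\to B(A^{\mathbb{Z}},\Sigma_c)$ is $g\mapsto (x\mapsto g(x,x))$.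
   Context: $\Sigma_c$ is the Borel $\sigma$-field of $A^{\mathbb{Z}}$ with the product topology (generated by cylinder sets); $B(A^{\mathbb{Z}},\Sigma_c)$ is the commutative $C^*$-algebra of bounded Borel complex functions with sup-norm. $\mathcal{B}^{\mathbb{Z}}$ is the quasi-local $C^*$-algebra built from $\mathcal{B}$ (norm completion of the union of finite tensor products $\bigotimes_{n\in\Lambda}\mathcal{B}$ over finite $\Lambda\subset\mathbb{Z}$ with natural embeddings $a\mapsto a\otimes\mathbf{1}$). Tensor products carry their unique $C^*$-norms. A cq-channel is a map $W:A^{\mathbb{Z}}\times\mathcal{B}^{\mathbb{Z}}\to\mathbb{C}$ such that $x\mapsto W(x,b)$ is Borel measurable for each $b$ and $b\mapsto W(x,b)$ is a state on $\mathcal{B}^{\mathbb{Z}}$ for each $x$.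
   Formalization: The identification of B(A^Z)⊗B(A^Z) with all of B(A^Z×A^Z) fails for |A|≥2 (the diagonal's indicator is not in the tensor product), so it is not asserted; Copy∘(id⊗K) is given directly by E(g)(x)=K(g(x))(x), viewing the tensor product as functions from A^Z to B^Z. *)

theory Defs
  imports "HOL-Analysis.Analysis"
begin

text \<open>The Hilbert space H is C^'h for a finite type 'h (its orthonormal basis), so
  B = L(H) is the algebra of 'h x 'h complex matrices.  For a finite region Lambda of Z,
  the local algebra (tensor over Lambda of B) = L(H^(tensor Lambda)) is the algebra of complex
  matrices indexed by configurations Lambda -> 'h.  We represent every local observable
  uniformly as a kernel on full configurations (int => 'h), namely its ampliation
  a (tensor) 1 (identity outside Lambda); then the natural embeddings a |-> a (tensor) 1 are
  literally the identity, and the union of the local algebras is the set of local kernels.\<close>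

type_synonym 'h config = "int \<Rightarrow> 'h"
type_synonym 'h kernel = "'h config \<Rightarrow> 'h config \<Rightarrow> complex"

definition local_kernel :: "'h kernel \<Rightarrow> bool" where
  "local_kernel k \<longleftrightarrow> (\<exists>\<Lambda>. finite \<Lambda> \<and>
     (\<forall>\<sigma> \<tau>. (\<exists>i. i \<notin> \<Lambda> \<and> \<sigma> i \<noteq> \<tau> i) \<longrightarrow> k \<sigma> \<tau> = 0) \<and>
     (\<forall>\<sigma> \<tau> \<sigma>' \<tau>'. (\<forall>i\<in>\<Lambda>. \<sigma> i = \<sigma>' i \<and> \<tau> i = \<tau>' i) \<and>
        (\<forall>i. i \<notin> \<Lambda> \<longrightarrow> \<sigma> i = \<tau> i \<and> \<sigma>' i = \<tau>' i) \<longrightarrow> k \<sigma> \<tau> = k \<sigma>' \<tau>'))"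

definition kzero :: "'h kernel" where "kzero = (\<lambda>\<sigma> \<tau>. 0)"
definition kone :: "'h kernel" where "kone = (\<lambda>\<sigma> \<tau>. if \<sigma> = \<tau> then 1 else 0)"
definition kadd :: "'h kernel \<Rightarrow> 'h kernel \<Rightarrow> 'h kernel" where
  "kadd k l = (\<lambda>\<sigma> \<tau>. k \<sigma> \<tau> + l \<sigma> \<tau>)"
definition kdiff :: "'h kernel \<Rightarrow> 'h kernel \<Rightarrow> 'h kernel" where
  "kdiff k l = (\<lambda>\<sigma> \<tau>. k \<sigma> \<tau> - l \<sigma> \<tau>)"
definition kscale :: "complex \<Rightarrow> 'h kernel \<Rightarrow> 'h kernel" where
  "kscale c k = (\<lambda>\<sigma> \<tau>. c * k \<sigma> \<tau>)"
text \<open>Matrix product; for local kernels only finitely many terms are nonzero.\<close>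
definition kmult :: "'h kernel \<Rightarrow> 'h kernel \<Rightarrow> 'h kernel" where
  "kmult k l = (\<lambda>\<sigma> \<tau>. \<Sum>\<^sub>\<infinity>\<rho>. k \<sigma> \<rho> * l \<rho> \<tau>)"
definition kstar :: "'h kernel \<Rightarrow> 'h kernel" where
  "kstar k = (\<lambda>\<sigma> \<tau>. cnj (k \<tau> \<sigma>))"

text \<open>The (unique) C*-norm of a local observable: its operator norm (acting on
  finitely supported l2-vectors over configurations; the ampliation is block diagonal
  with identical blocks, so this is the operator norm of the local matrix).\<close>
definition opnorm :: "'h kernel \<Rightarrow> real" where
  "opnorm k = Sup {sqrt (\<Sum>\<^sub>\<infinity>\<sigma>. (cmod (\<Sum>\<^sub>\<infinity>\<tau>. k \<sigma> \<tau> * v \<tau>))\<^sup>2) | v.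
       finite {\<tau>. v \<tau> \<noteq> 0} \<and> (\<Sum>\<^sub>\<infinity>\<tau>. (cmod (v \<tau>))\<^sup>2) \<le> 1}"

definition kcauchy :: "(nat \<Rightarrow> 'h kernel) \<Rightarrow> bool" where
  "kcauchy u \<longleftrightarrow> (\<forall>n. local_kernel (u n)) \<and>
     (\<forall>e>0. \<exists>N. \<forall>m\<ge>N. \<forall>n\<ge>N. opnorm (kdiff (u m) (u n)) < e)"

definition kcls :: "(nat \<Rightarrow> 'h kernel) \<Rightarrow> (nat \<Rightarrow> 'h kernel) set" where
  "kcls u = {v. kcauchy v \<and> (\<lambda>n. opnorm (kdiff (u n) (v n))) \<longlonglongrightarrow> 0}"

lemma kcauchy_zero: "kcauchy (\<lambda>_. (kzero :: 'h kernel))"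
proof -
  have loc: "local_kernel (kzero :: 'h kernel)"
    unfolding local_kernel_def kzero_def by (rule exI[of _ "{}"]) auto
  have "opnorm (kdiff (kzero :: 'h kernel) kzero) = 0"
  proof -
    have "{sqrt (\<Sum>\<^sub>\<infinity>\<sigma>. (cmod (\<Sum>\<^sub>\<infinity>\<tau>. kdiff (kzero::'h kernel) kzero \<sigma> \<tau> * v \<tau>))\<^sup>2) | v.
       finite {\<tau>. v \<tau> \<noteq> 0} \<and> (\<Sum>\<^sub>\<infinity>\<tau>. (cmod (v \<tau>))\<^sup>2) \<le> 1} = {0}"
      by (auto simp: kdiff_def kzero_def intro!: exI[of _ "\<lambda>_. 0"])
    then show ?thesis unfolding opnorm_def by simp
  qed
  then have "\<forall>e>0. \<exists>N. \<forall>m\<ge>N. \<forall>n\<ge>N. opnorm (kdiff (kzero :: 'h kernel) kzero) < e" by auto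
  then show ?thesis using loc unfolding kcauchy_def by blast
qed

typedef 'h qloc = "{C. \<exists>u :: nat \<Rightarrow> 'h kernel. kcauchy u \<and> C = kcls u}"
  using kcauchy_zero by blast

definition rep_seq :: "'h qloc \<Rightarrow> nat \<Rightarrow> 'h kernel" where
  "rep_seq x = (SOME u. u \<in> Rep_qloc x)"

definition qof :: "(nat \<Rightarrow> 'h kernel) \<Rightarrow> 'h qloc" where
  "qof u = Abs_qloc (kcls u)"

definition qzero :: "'h qloc" where "qzero = qof (\<lambda>_. kzero)"
definition qone :: "'h qloc" where "qone = qof (\<lambda>_. kone)"
definition qadd :: "'h qloc \<Rightarrow> 'h qloc \<Rightarrow> 'h qloc" where
  "qadd x y = qof (\<lambda>n. kadd (rep_seq x n) (rep_seq y n))"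
definition qdiff :: "'h qloc \<Rightarrow> 'h qloc \<Rightarrow> 'h qloc" where
  "qdiff x y = qof (\<lambda>n. kdiff (rep_seq x n) (rep_seq y n))"
definition qscale :: "complex \<Rightarrow> 'h qloc \<Rightarrow> 'h qloc" where
  "qscale c x = qof (\<lambda>n. kscale c (rep_seq x n))"
definition qmult :: "'h qloc \<Rightarrow> 'h qloc \<Rightarrow> 'h qloc" where
  "qmult x y = qof (\<lambda>n. kmult (rep_seq x n) (rep_seq y n))"
definition qstar :: "'h qloc \<Rightarrow> 'h qloc" where
  "qstar x = qof (\<lambda>n. kstar (rep_seq x n))"
definition qnorm :: "'h qloc \<Rightarrow> real" where
  "qnorm x = lim (\<lambda>n. opnorm (rep_seq x n))"

primrec qsumN :: "nat \<Rightarrow> (nat \<Rightarrow> 'h qloc) \<Rightarrow> 'h qloc" where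
  "qsumN 0 b = qzero"
| "qsumN (Suc n) b = qadd (qsumN n b) (b n)"

definition qpos :: "'h qloc \<Rightarrow> bool" where
  "qpos x \<longleftrightarrow> (\<exists>y. x = qmult (qstar y) y)"

definition cnonneg :: "complex \<Rightarrow> bool" where
  "cnonneg z \<longleftrightarrow> Im z = 0 \<and> 0 \<le> Re z"

definition cylinders :: "('a config) set set" where
  "cylinders = {C. \<exists>\<Lambda> c. finite \<Lambda> \<and> C = {x. \<forall>i\<in>\<Lambda>. x i = c i}}"

definition SigmaC :: "('a config) measure" where
  "SigmaC = sigma UNIV cylinders"

definition Bfun :: "('a config \<Rightarrow> complex) set" where
  "Bfun = {f. f \<in> borel_measurable SigmaC \<and> bounded (range f)}"

text \<open>Realised as the sup-norm closure, inside bounded functions A^Z -> B^Z, of the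
  algebraic tensor product spanned by the functions x |-> f(x) b (f in B(A^Z), b in B^Z);
  since the point evaluations are weak*-dense in the spectrum of B(A^Z), this sup-norm is
  the (unique) C*-norm.  Algebra operations are pointwise.\<close>
definition tens :: "('a config \<Rightarrow> 'h qloc) set" where
  "tens = {g. \<forall>e>0. \<exists>N fs bs. (\<forall>i<N. fs i \<in> Bfun) \<and>
      (\<forall>x. qnorm (qdiff (g x) (qsumN N (\<lambda>i. qscale (fs i x) (bs i)))) \<le> e)}"

definition tens_pos :: "('a config \<Rightarrow> 'h qloc) \<Rightarrow> bool" where
  "tens_pos g \<longleftrightarrow> (\<exists>h\<in>tens. \<forall>x. g x = qmult (qstar (h x)) (h x))"

definition is_state :: "('h qloc \<Rightarrow> complex) \<Rightarrow> bool" where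
  "is_state \<omega> \<longleftrightarrow> (\<forall>a b. \<omega> (qadd a b) = \<omega> a + \<omega> b) \<and> (\<forall>c a. \<omega> (qscale c a) = c * \<omega> a)
      \<and> (\<forall>a. qpos a \<longrightarrow> cnonneg (\<omega> a)) \<and> \<omega> qone = 1"

definition cq_channels :: "('a config \<Rightarrow> 'h qloc \<Rightarrow> complex) set" where
  "cq_channels = {W. (\<forall>b. (\<lambda>x. W x b) \<in> borel_measurable SigmaC) \<and> (\<forall>x. is_state (W x))}"

definition K_maps :: "('h qloc \<Rightarrow> ('a config \<Rightarrow> complex)) set" where
  "K_maps = {K. (\<forall>b. K b \<in> Bfun)
     \<and> (\<forall>a b. K (qadd a b) = (\<lambda>x. K a x + K b x))
     \<and> (\<forall>c a. K (qscale c a) = (\<lambda>x. c * K a x))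
     \<and> (\<forall>a. qpos a \<longrightarrow> (\<forall>x. cnonneg (K a x)))
     \<and> K qone = (\<lambda>x. 1)}"

text \<open>Maps on the tensor product; as HOL functions they are total, so we fix the
  convention that they vanish outside the carrier tens.\<close>
definition E_maps :: "(('a config \<Rightarrow> 'h qloc) \<Rightarrow> ('a config \<Rightarrow> complex)) set" where
  "E_maps = {E. (\<forall>g\<in>tens. E g \<in> Bfun)
     \<and> (\<forall>g\<in>tens. \<forall>h\<in>tens. E (\<lambda>x. qadd (g x) (h x)) = (\<lambda>x. E g x + E h x))
     \<and> (\<forall>c. \<forall>g\<in>tens. E (\<lambda>x. qscale c (g x)) = (\<lambda>x. c * E g x))
     \<and> (\<forall>g\<in>tens. tens_pos g \<longrightarrow> (\<forall>x. cnonneg (E g x)))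
     \<and> E (\<lambda>x. qone) = (\<lambda>x. 1)
     \<and> (\<forall>f\<in>Bfun. \<forall>b. E (\<lambda>x. qscale (f x) b) = (\<lambda>x. f x * E (\<lambda>y. b) x))
     \<and> (\<forall>g. g \<notin> tens \<longrightarrow> E g = (\<lambda>x. 0))}"

text \<open>The correspondences: K(b)(x) = W(x,b), and E = Copy o (id (tensor) K),
  i.e. E(g)(x) = K(g(x))(x).\<close>
definition W_to_K :: "('a config \<Rightarrow> 'h qloc \<Rightarrow> complex) \<Rightarrow> ('h qloc \<Rightarrow> 'a config \<Rightarrow> complex)" where
  "W_to_K W = (\<lambda>b x. W x b)"

definition K_to_E :: "('h qloc \<Rightarrow> 'a config \<Rightarrow> complex) \<Rightarrow> (('a config \<Rightarrow> 'h qloc) \<Rightarrow> 'a config \<Rightarrow> complex)" where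
  "K_to_E K = (\<lambda>g. if g \<in> tens then (\<lambda>x. K (g x) x) else (\<lambda>x. 0))"

end

theory Submission
  imports Defs
begin

text \<open>The point is that positivity forces continuity.  In the Banach algebra of the quasi-local
  observables, \<open>1 - b\<close> is the square of a self-adjoint element whenever \<open>b\<close> is self-adjoint with
  \<open>\<parallel>b\<parallel> < 1\<close>, by the binomial series; the same series, converging uniformly, takes square roots
  inside the tensor product with the bounded Borel functions.  Hence a positive unital functional on
  either algebra is bounded by a universal multiple of the norm.  For states this makes \<open>W(x, b)\<close>
  bounded in \<open>x\<close>; for \<open>E\<close> it means that \<open>E\<close> is determined by its values on elementary tensors,
  where the module property gives \<open>E(f \<otimes> b) = f E(1 \<otimes> b)\<close>.\<close>

section \<open>Local kernels\<close>

text \<open>The quasi-local algebra arrives as bare classes of Cauchy sequences, with operations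
  computed on representatives picked by SOME and a norm defined as a supremum of infinite sums.
  Series can be summed in it only after it has become a Banach algebra in the sense of the type
  classes, and most of the text serves that end. Positivity in the tensor product means having a
  root inside \<open>tens\<close>, not positivity at each point, so roots must come from a procedure
  that converges uniformly in x; a power series with a numerical majorant does this. One bound for
  functionals on \<open>tens\<close> serves both uses: E is evaluated at a fixed x, and a state is
  composed with a point evaluation. Its factor 4 comes from splitting an element into two
  self-adjoint parts and from working with norm 1/2, safely inside the unit ball. Any constant
  independent of the functional would serve, because the bound is used only for boundedness in x and
  for passing to limits.\<close>

definition local_on :: "int set \<Rightarrow> 'h kernel \<Rightarrow> bool" where
  "local_on \<Lambda> k \<longleftrightarrow>
     (\<forall>\<sigma> \<tau>. (\<exists>i. i \<notin> \<Lambda> \<and> \<sigma> i \<noteq> \<tau> i) \<longrightarrow> k \<sigma> \<tau> = 0) \<and>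
     (\<forall>\<sigma> \<tau> \<sigma>' \<tau>'. (\<forall>i\<in>\<Lambda>. \<sigma> i = \<sigma>' i \<and> \<tau> i = \<tau>' i) \<and>
        (\<forall>i. i \<notin> \<Lambda> \<longrightarrow> \<sigma> i = \<tau> i \<and> \<sigma>' i = \<tau>' i) \<longrightarrow> k \<sigma> \<tau> = k \<sigma>' \<tau>')"

lemma local_kernel_iff: "local_kernel k \<longleftrightarrow> (\<exists>\<Lambda>. finite \<Lambda> \<and> local_on \<Lambda> k)"
  by (simp add: local_kernel_def local_on_def)

lemma local_on_zero: "local_on \<Lambda> k \<Longrightarrow> i \<notin> \<Lambda> \<Longrightarrow> \<sigma> i \<noteq> \<tau> i \<Longrightarrow> k \<sigma> \<tau> = 0"
  by (auto simp: local_on_def)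

lemma local_on_cong:
  assumes "local_on \<Lambda> k" "\<And>i. i \<in> \<Lambda> \<Longrightarrow> \<sigma> i = \<sigma>' i" "\<And>i. i \<in> \<Lambda> \<Longrightarrow> \<tau> i = \<tau>' i"
    "\<And>i. i \<notin> \<Lambda> \<Longrightarrow> \<sigma> i = \<tau> i" "\<And>i. i \<notin> \<Lambda> \<Longrightarrow> \<sigma>' i = \<tau>' i"
  shows "k \<sigma> \<tau> = k \<sigma>' \<tau>'"
  using assms unfolding local_on_def by blast

text \<open>If \<sigma> and \<tau> differ at a coordinate outside \<Lambda>, then \<sigma>' and
  \<tau>' differ there too, and both entries vanish. Otherwise the four configurations already
  satisfy the agreement conditions for the smaller region.\<close>

lemma local_on_mono:
  fixes k :: "'h kernel"
  assumes k: "local_on \<Lambda> k" and sub: "\<Lambda> \<subseteq> \<Lambda>'"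
  shows "local_on \<Lambda>' k"
  unfolding local_on_def
proof (intro conjI allI impI)
  fix \<sigma> \<tau> :: "'h config" assume "\<exists>i. i \<notin> \<Lambda>' \<and> \<sigma> i \<noteq> \<tau> i"
  then show "k \<sigma> \<tau> = 0" using local_on_zero[OF k] sub by blast
next
  fix \<sigma> \<tau> \<sigma>' \<tau>' :: "'h config"
  assume *: "(\<forall>i\<in>\<Lambda>'. \<sigma> i = \<sigma>' i \<and> \<tau> i = \<tau>' i) \<and>
        (\<forall>i. i \<notin> \<Lambda>' \<longrightarrow> \<sigma> i = \<tau> i \<and> \<sigma>' i = \<tau>' i)"
  show "k \<sigma> \<tau> = k \<sigma>' \<tau>'"
  proof (cases "\<exists>i. i \<notin> \<Lambda> \<and> \<sigma> i \<noteq> \<tau> i")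
    case True
    then obtain i where i: "i \<notin> \<Lambda>" "\<sigma> i \<noteq> \<tau> i" by blast
    with * have "\<sigma>' i \<noteq> \<tau>' i" by metis
    with i show ?thesis using local_on_zero[OF k] by metis
  next
    case False
    show ?thesis by (rule local_on_cong[OF k]) (use * False sub in \<open>blast | metis\<close>)+
  qed
qed

text \<open>Naming the region, as \<open>local_on\<close> does, allows finitely many observables to
  be moved to one common region, where sums and products can be computed.\<close>

lemma local_kernels_common:
  assumes "finite K" "\<forall>k\<in>K. local_kernel k"
  obtains \<Lambda> where "finite \<Lambda>" "\<forall>k\<in>K. local_on \<Lambda> k"
proof -
  from assms(2) have "\<forall>k\<in>K. \<exists>\<Lambda>. finite \<Lambda> \<and> local_on \<Lambda> k" by (simp add: local_kernel_iff)
  then obtain L where L: "\<forall>k\<in>K. finite (L k) \<and> local_on (L k) k" by metis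
  show ?thesis
  proof
    show "finite (\<Union>k\<in>K. L k)" using assms(1) L by blast
    show "\<forall>k\<in>K. local_on (\<Union>k\<in>K. L k) k" using L local_on_mono by blast
  qed
qed

section \<open>Blocks and finite invariant sets\<close>

definition block :: "int set \<Rightarrow> 'h config \<Rightarrow> 'h config set" where
  "block \<Lambda> \<sigma> = {\<tau>. \<forall>i. i \<notin> \<Lambda> \<longrightarrow> \<tau> i = \<sigma> i}"

lemma inj_on_restrict_block: "inj_on (\<lambda>\<tau>. restrict \<tau> \<Lambda>) (block \<Lambda> \<sigma>)"
proof (rule inj_onI)
  fix \<tau> \<tau>' assume *: "\<tau> \<in> block \<Lambda> \<sigma>" "\<tau>' \<in> block \<Lambda> \<sigma>" "restrict \<tau> \<Lambda> = restrict \<tau>' \<Lambda>"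
  show "\<tau> = \<tau>'"
  proof
    fix i show "\<tau> i = \<tau>' i"
      using * by (cases "i \<in> \<Lambda>") (auto simp: block_def dest: fun_cong[where x=i])
  qed
qed

text \<open>A block is a copy of the set of maps from \<Lambda> to \<open>'h\<close>; this is where
  finiteness of \<open>'h\<close> first enters.\<close>

lemma finite_block:
  fixes \<sigma> :: "'h::finite config"
  assumes "finite \<Lambda>"
  shows "finite (block \<Lambda> \<sigma>)"
proof -
  have "(\<lambda>\<tau>. restrict \<tau> \<Lambda>) ` block \<Lambda> \<sigma> \<subseteq> \<Lambda> \<rightarrow>\<^sub>E UNIV" by auto
  moreover have "finite (\<Lambda> \<rightarrow>\<^sub>E (UNIV :: 'h set))" using assms by (intro finite_PiE) auto
  ultimately show ?thesis using inj_on_restrict_block finite_imageD finite_subset by metis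
qed

text \<open>Block diagonality with respect to F and its complement. On a finite such set the
  infinite sums in \<open>kmult\<close> and in the action on vectors become those of ordinary finite
  matrices.\<close>

definition invariant :: "'h kernel \<Rightarrow> 'h config set \<Rightarrow> bool" where
  "invariant k F \<longleftrightarrow> (\<forall>\<sigma> \<tau>. k \<sigma> \<tau> \<noteq> 0 \<longrightarrow> (\<sigma> \<in> F \<longleftrightarrow> \<tau> \<in> F))"

lemma invariant_zero: "invariant k F \<Longrightarrow> (\<sigma> \<in> F) \<noteq> (\<tau> \<in> F) \<Longrightarrow> k \<sigma> \<tau> = 0"
  by (auto simp: invariant_def)

lemma local_on_invariant_block:
  assumes "local_on \<Lambda> k"
  shows "invariant k (block \<Lambda> \<sigma>)"
  unfolding invariant_def
proof (intro allI impI)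
  fix \<rho> \<tau> assume "k \<rho> \<tau> \<noteq> 0"
  then have "\<forall>i. i \<notin> \<Lambda> \<longrightarrow> \<rho> i = \<tau> i" using local_on_zero[OF assms] by blast
  then show "\<rho> \<in> block \<Lambda> \<sigma> \<longleftrightarrow> \<tau> \<in> block \<Lambda> \<sigma>" by (auto simp: block_def)
qed

lemma invariant_Union: "(\<And>B. B \<in> \<B> \<Longrightarrow> invariant k B) \<Longrightarrow> invariant k (\<Union>\<B>)"
  by (auto simp: invariant_def)

text \<open>The union of the blocks through the points of \<open>F0\<close>, taken over a common
  region. Most matrix identities below are checked inside such a set.\<close>

lemma local_kernels_invariant:
  fixes K :: "'h::finite kernel set"
  assumes "finite K" "\<forall>k\<in>K. local_kernel k" "finite F0"
  obtains F where "finite F" "F0 \<subseteq> F" "\<forall>k\<in>K. invariant k F"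
proof -
  obtain \<Lambda> where \<Lambda>: "finite \<Lambda>" "\<forall>k\<in>K. local_on \<Lambda> k"
    using local_kernels_common assms by metis
  show ?thesis
  proof
    show "finite (\<Union>(block \<Lambda> ` F0))" using finite_block[OF \<Lambda>(1)] assms(3) by blast
    show "F0 \<subseteq> \<Union>(block \<Lambda> ` F0)" by (auto simp: block_def)
    show "\<forall>k\<in>K. invariant k (\<Union>(block \<Lambda> ` F0))"
      using \<Lambda>(2) local_on_invariant_block by (blast intro!: invariant_Union)
  qed
qed

lemma infsum_eq_sum:
  fixes f :: "'x \<Rightarrow> 'y::{comm_monoid_add,t2_space}"
  assumes "finite F" "\<And>x. x \<notin> F \<Longrightarrow> f x = 0"
  shows "(\<Sum>\<^sub>\<infinity>x. f x) = sum f F"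
  using assms infsum_cong_neutral[of F UNIV f f] by simp

text \<open>A summation index outside F kills one of the two factors, and a single invariant factor
  whose outer index lies in F is enough for that. The disjunction lets distributivity be proved with
  only the common factor known to be local.\<close>

lemma kmult_eq_sum:
  assumes "finite F" "invariant k F \<and> \<sigma> \<in> F \<or> invariant l F \<and> \<tau> \<in> F"
  shows "kmult k l \<sigma> \<tau> = (\<Sum>\<rho>\<in>F. k \<sigma> \<rho> * l \<rho> \<tau>)"
  unfolding kmult_def
  by (rule infsum_eq_sum) (use assms invariant_zero in \<open>auto\<close>)

lemma kmult_eq_0:
  assumes "invariant k F" "invariant l F" "(\<sigma> \<in> F) \<noteq> (\<tau> \<in> F)"
  shows "kmult k l \<sigma> \<tau> = 0"
proof -
  have "k \<sigma> \<rho> * l \<rho> \<tau> = 0" for \<rho>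
    using assms invariant_zero[of k F \<sigma> \<rho>] invariant_zero[of l F \<rho> \<tau>] by auto
  then have "(\<lambda>\<rho>. k \<sigma> \<rho> * l \<rho> \<tau>) = (\<lambda>_. 0)" by (rule ext)
  then show ?thesis by (simp only: kmult_def infsum_0_simp)
qed

lemma local_on_kmult:
  fixes k l :: "'h::finite kernel"
  assumes fin: "finite \<Lambda>" and k: "local_on \<Lambda> k" and l: "local_on \<Lambda> l"
  shows "local_on \<Lambda> (kmult k l)"
  unfolding local_on_def
proof (intro conjI allI impI)
  fix \<sigma> \<tau> :: "'h config" assume "\<exists>i. i \<notin> \<Lambda> \<and> \<sigma> i \<noteq> \<tau> i"
  then show "kmult k l \<sigma> \<tau> = 0"
    by (intro kmult_eq_0[OF local_on_invariant_block[OF k, of \<sigma>] local_on_invariant_block[OF l, of \<sigma>]])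
       (auto simp: block_def)
next
  fix \<sigma> \<tau> \<sigma>' \<tau>' :: "'h config"
  assume *: "(\<forall>i\<in>\<Lambda>. \<sigma> i = \<sigma>' i \<and> \<tau> i = \<tau>' i) \<and>
        (\<forall>i. i \<notin> \<Lambda> \<longrightarrow> \<sigma> i = \<tau> i \<and> \<sigma>' i = \<tau>' i)"
  have "kmult k l \<sigma> \<tau> = (\<Sum>\<rho>\<in>block \<Lambda> \<sigma>. k \<sigma> \<rho> * l \<rho> \<tau>)"
    by (rule kmult_eq_sum)
       (use fin finite_block local_on_invariant_block[OF k] in \<open>auto simp: block_def\<close>)
  also have "\<dots> = (\<Sum>\<rho>\<in>block \<Lambda> \<sigma>'. k \<sigma>' \<rho> * l \<rho> \<tau>')"
  proof (rule sum.reindex_bij_witness[where i="\<lambda>\<rho> i. if i \<in> \<Lambda> then \<rho> i else \<sigma> i"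
        and j="\<lambda>\<rho> i. if i \<in> \<Lambda> then \<rho> i else \<sigma>' i"])
    fix \<rho> assume \<rho>: "\<rho> \<in> block \<Lambda> \<sigma>"
    let ?\<rho>' = "\<lambda>i. if i \<in> \<Lambda> then \<rho> i else \<sigma>' i"
    have "k \<sigma>' ?\<rho>' = k \<sigma> \<rho>"
      by (rule local_on_cong[OF k]) (use * \<rho> in \<open>auto simp: block_def\<close>)
    moreover have "l ?\<rho>' \<tau>' = l \<rho> \<tau>"
      by (rule local_on_cong[OF l]) (use * \<rho> in \<open>auto simp: block_def\<close>)
    ultimately show "k \<sigma>' ?\<rho>' * l ?\<rho>' \<tau>' = k \<sigma> \<rho> * l \<rho> \<tau>" by simp
  qed (auto simp: block_def fun_eq_iff)
  also have "\<dots> = kmult k l \<sigma>' \<tau>'"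
    by (rule kmult_eq_sum[symmetric])
       (use fin finite_block local_on_invariant_block[OF k] in \<open>auto simp: block_def\<close>)
  finally show "kmult k l \<sigma> \<tau> = kmult k l \<sigma>' \<tau>'" .
qed

lemma local_kernel_common2:
  fixes k l :: "'h kernel"
  assumes "local_kernel k" "local_kernel l"
  obtains \<Lambda> where "finite \<Lambda>" "local_on \<Lambda> k" "local_on \<Lambda> l"
  using local_kernels_common[of "{k, l}"] assms by auto

lemma local_kernel_kmult:
  fixes k l :: "'h::finite kernel"
  shows "local_kernel k \<Longrightarrow> local_kernel l \<Longrightarrow> local_kernel (kmult k l)"
  by (erule local_kernel_common2, assumption) (auto simp: local_kernel_iff intro: local_on_kmult)

text \<open>One statement for sums, differences and scalar multiples; \<open>f 0 0 = 0\<close>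
  preserves the vanishing of entries between different blocks.\<close>

lemma local_on_pointwise2:
  fixes k l :: "'h kernel"
  assumes k: "local_on \<Lambda> k" and l: "local_on \<Lambda> l" and f: "f 0 0 = (0::complex)"
  shows "local_on \<Lambda> (\<lambda>\<sigma> \<tau>. f (k \<sigma> \<tau>) (l \<sigma> \<tau>))"
  unfolding local_on_def
proof (intro conjI allI impI)
  fix \<sigma> \<tau> \<sigma>' \<tau>' :: "'h config"
  assume *: "(\<forall>i\<in>\<Lambda>. \<sigma> i = \<sigma>' i \<and> \<tau> i = \<tau>' i) \<and>
        (\<forall>i. i \<notin> \<Lambda> \<longrightarrow> \<sigma> i = \<tau> i \<and> \<sigma>' i = \<tau>' i)"
  have "k \<sigma> \<tau> = k \<sigma>' \<tau>'" "l \<sigma> \<tau> = l \<sigma>' \<tau>'"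
    by (rule local_on_cong[OF k] local_on_cong[OF l]; use * in blast)+
  then show "f (k \<sigma> \<tau>) (l \<sigma> \<tau>) = f (k \<sigma>' \<tau>') (l \<sigma>' \<tau>')" by simp
qed (use local_on_zero[OF k] local_on_zero[OF l] f in metis)

lemma local_kernel_pointwise2:
  fixes k l :: "'h kernel"
  shows "local_kernel k \<Longrightarrow> local_kernel l \<Longrightarrow> f 0 0 = (0::complex) \<Longrightarrow>
    local_kernel (\<lambda>\<sigma> \<tau>. f (k \<sigma> \<tau>) (l \<sigma> \<tau>))"
  by (erule local_kernel_common2, assumption) (auto simp: local_kernel_iff intro: local_on_pointwise2)

lemma local_kernel_kadd:
  fixes k l :: "'h kernel"
  shows "local_kernel k \<Longrightarrow> local_kernel l \<Longrightarrow> local_kernel (kadd k l)"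
  and local_kernel_kdiff: "local_kernel k \<Longrightarrow> local_kernel l \<Longrightarrow> local_kernel (kdiff k l)"
  and local_kernel_kscale: "local_kernel k \<Longrightarrow> local_kernel (kscale c k)"
  using local_kernel_pointwise2[of k l "(+)"] local_kernel_pointwise2[of k l "(-)"]
    local_kernel_pointwise2[of k k "\<lambda>z _. c * z"]
  by (simp_all add: kadd_def kdiff_def kscale_def)

lemma local_kernel_kzero: "local_kernel kzero"
  by (auto simp: local_kernel_iff local_on_def kzero_def intro!: exI[of _ "{}"])

lemma local_kernel_kone: "local_kernel kone"
  by (auto simp: local_kernel_iff local_on_def kone_def intro!: exI[of _ "{}"])

lemma local_kernel_kstar:
  fixes k :: "'h kernel"
  shows "local_kernel k \<Longrightarrow> local_kernel (kstar k)"
  unfolding local_kernel_iff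
proof (elim exE conjE, intro exI conjI)
  fix \<Lambda> assume k: "local_on \<Lambda> k"
  show "local_on \<Lambda> (kstar k)"
    unfolding local_on_def kstar_def
  proof (intro conjI allI impI)
    fix \<sigma> \<tau> :: "'h config" assume "\<exists>i. i \<notin> \<Lambda> \<and> \<sigma> i \<noteq> \<tau> i"
    then show "cnj (k \<tau> \<sigma>) = 0" using local_on_zero[OF k] by (metis complex_cnj_zero)
  next
    fix \<sigma> \<tau> \<sigma>' \<tau>' :: "'h config"
    assume *: "(\<forall>i\<in>\<Lambda>. \<sigma> i = \<sigma>' i \<and> \<tau> i = \<tau>' i) \<and>
          (\<forall>i. i \<notin> \<Lambda> \<longrightarrow> \<sigma> i = \<tau> i \<and> \<sigma>' i = \<tau>' i)"
    have "k \<tau> \<sigma> = k \<tau>' \<sigma>'" by (rule local_on_cong[OF k]) (use * in \<open>auto\<close>)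
    then show "cnj (k \<tau> \<sigma>) = cnj (k \<tau>' \<sigma>')" by simp
  qed
qed

section \<open>Algebraic laws of local kernels\<close>

lemma kmult_assoc:
  fixes k l m :: "'h::finite kernel"
  assumes "local_kernel k" "local_kernel l" "local_kernel m"
  shows "kmult (kmult k l) m = kmult k (kmult l m)"
proof (intro ext)
  fix \<sigma> \<tau>
  obtain F where F: "finite F" "{\<sigma>, \<tau>} \<subseteq> F" "\<forall>n\<in>{k, l, m}. invariant n F"
    by (rule local_kernels_invariant[of "{k, l, m}" "{\<sigma>, \<tau>}"]) (use assms in auto)
  then have inv: "invariant k F" "invariant l F" "invariant m F" and in_F: "\<sigma> \<in> F" "\<tau> \<in> F" by auto
  have "kmult (kmult k l) m \<sigma> \<tau> = (\<Sum>\<rho>\<in>F. (\<Sum>\<rho>'\<in>F. k \<sigma> \<rho>' * l \<rho>' \<rho>) * m \<rho> \<tau>)"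
    using F(1) inv in_F by (simp add: kmult_eq_sum)
  also have "\<dots> = (\<Sum>\<rho>'\<in>F. k \<sigma> \<rho>' * (\<Sum>\<rho>\<in>F. l \<rho>' \<rho> * m \<rho> \<tau>))"
    unfolding sum_distrib_left sum_distrib_right mult.assoc by (rule sum.swap)
  also have "\<dots> = kmult k (kmult l m) \<sigma> \<tau>"
    using F(1) inv in_F by (simp add: kmult_eq_sum)
  finally show "kmult (kmult k l) m \<sigma> \<tau> = kmult k (kmult l m) \<sigma> \<tau>" .
qed

lemma kmult_kadd_right:
  fixes k l m :: "'h::finite kernel"
  assumes "local_kernel k"
  shows "kmult k (kadd l m) = kadd (kmult k l) (kmult k m)"
proof (intro ext)
  fix \<sigma> \<tau>
  obtain F where F: "finite F" "{\<sigma>} \<subseteq> F" "\<forall>n\<in>{k}. invariant n F"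
    by (rule local_kernels_invariant[of "{k}" "{\<sigma>}"]) (use assms in auto)
  then show "kmult k (kadd l m) \<sigma> \<tau> = kadd (kmult k l) (kmult k m) \<sigma> \<tau>"
    by (simp add: kmult_eq_sum[of F] kadd_def ring_distribs sum.distrib)
qed

lemma kmult_kadd_left:
  fixes k l m :: "'h::finite kernel"
  assumes "local_kernel m"
  shows "kmult (kadd k l) m = kadd (kmult k m) (kmult l m)"
proof (intro ext)
  fix \<sigma> \<tau>
  obtain F where F: "finite F" "{\<tau>} \<subseteq> F" "\<forall>n\<in>{m}. invariant n F"
    by (rule local_kernels_invariant[of "{m}" "{\<tau>}"]) (use assms in auto)
  then show "kmult (kadd k l) m \<sigma> \<tau> = kadd (kmult k m) (kmult l m) \<sigma> \<tau>"
    by (simp add: kmult_eq_sum[of F] kadd_def ring_distribs sum.distrib)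
qed

lemma kmult_kone_left: "kmult kone k = k"
proof (intro ext)
  fix \<sigma> \<tau>
  have "kmult kone k \<sigma> \<tau> = (\<Sum>\<rho>\<in>{\<sigma>}. kone \<sigma> \<rho> * k \<rho> \<tau>)"
    unfolding kmult_def by (rule infsum_eq_sum) (auto simp: kone_def)
  then show "kmult kone k \<sigma> \<tau> = k \<sigma> \<tau>" by (simp add: kone_def)
qed

lemma kmult_kone_right: "kmult k kone = k"
proof (intro ext)
  fix \<sigma> \<tau>
  have "kmult k kone \<sigma> \<tau> = (\<Sum>\<rho>\<in>{\<tau>}. k \<sigma> \<rho> * kone \<rho> \<tau>)"
    unfolding kmult_def by (rule infsum_eq_sum) (auto simp: kone_def)
  then show "kmult k kone \<sigma> \<tau> = k \<sigma> \<tau>" by (simp add: kone_def)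
qed

lemma kmult_kscale_left: "kmult (kscale c k) l = kscale c (kmult k l)"
  by (simp add: kmult_def kscale_def mult.assoc infsum_cmult_right' fun_eq_iff)

lemma kmult_kscale_right: "kmult k (kscale c l) = kscale c (kmult k l)"
  by (simp add: kmult_def kscale_def mult.left_commute[of _ c] infsum_cmult_right' fun_eq_iff)

lemma kstar_kmult: "kstar (kmult k l) = kmult (kstar l) (kstar k)"
proof (intro ext)
  fix \<sigma> \<tau>
  have "kstar (kmult k l) \<sigma> \<tau> = (\<Sum>\<^sub>\<infinity>\<rho>. cnj (k \<tau> \<rho> * l \<rho> \<sigma>))"
    by (simp only: kstar_def kmult_def infsum_cnj)
  also have "\<dots> = kmult (kstar l) (kstar k) \<sigma> \<tau>"
    unfolding kstar_def kmult_def by (intro infsum_cong) (simp add: mult.commute)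
  finally show "kstar (kmult k l) \<sigma> \<tau> = kmult (kstar l) (kstar k) \<sigma> \<tau>" .
qed

subsection \<open>The operator norm\<close>

definition app :: "'h kernel \<Rightarrow> ('h config \<Rightarrow> complex) \<Rightarrow> 'h config \<Rightarrow> complex" where
  "app k v = (\<lambda>\<sigma>. \<Sum>\<^sub>\<infinity>\<tau>. k \<sigma> \<tau> * v \<tau>)"

definition l2 :: "('x \<Rightarrow> complex) \<Rightarrow> real" where
  "l2 v = sqrt (\<Sum>\<^sub>\<infinity>\<sigma>. (cmod (v \<sigma>))\<^sup>2)"

definition supp :: "('x \<Rightarrow> complex) \<Rightarrow> 'x set" where
  "supp v = {\<tau>. v \<tau> \<noteq> 0}"

lemma supp_out: "supp v \<subseteq> F \<Longrightarrow> x \<notin> F \<Longrightarrow> v x = 0"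
  by (auto simp: supp_def)

lemma app_eq_sum:
  assumes "finite F" "supp v \<subseteq> F"
  shows "app k v \<sigma> = (\<Sum>\<tau>\<in>F. k \<sigma> \<tau> * v \<tau>)"
  unfolding app_def by (rule infsum_eq_sum) (use assms in \<open>auto simp: supp_out\<close>)

lemma l2_eq_L2_set:
  assumes "finite F" "supp v \<subseteq> F"
  shows "l2 v = L2_set (\<lambda>x. cmod (v x)) F"
  unfolding l2_def L2_set_def
  by (rule arg_cong[where f=sqrt], rule infsum_eq_sum) (use assms in \<open>auto simp: supp_out\<close>)

lemma l2_nonneg: "0 \<le> l2 v"
  by (simp add: l2_def infsum_nonneg)

lemma supp_app:
  assumes "finite F" "supp v \<subseteq> F" "invariant k F"
  shows "supp (app k v) \<subseteq> F"
proof
  fix \<sigma> assume "\<sigma> \<in> supp (app k v)"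
  then have "(\<Sum>\<tau>\<in>F. k \<sigma> \<tau> * v \<tau>) \<noteq> 0" using app_eq_sum[OF assms(1,2)] by (simp add: supp_def)
  then obtain \<tau> where "\<tau> \<in> F" "k \<sigma> \<tau> \<noteq> 0" by (metis (no_types, lifting) mult_zero_left sum.neutral)
  then show "\<sigma> \<in> F" using assms(3) by (auto simp: invariant_def)
qed

lemma finite_supp_app:
  fixes k :: "'h::finite kernel"
  assumes "local_kernel k" "finite (supp v)"
  shows "finite (supp (app k v))"
proof -
  obtain F where F: "finite F" "supp v \<subseteq> F" "\<forall>n\<in>{k}. invariant n F"
    by (rule local_kernels_invariant[of "{k}" "supp v"]) (use assms in auto)
  then have "supp (app k v) \<subseteq> F" by (intro supp_app) simp_all
  then show ?thesis using F(1) by (rule finite_subset)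
qed

lemma app_kmult:
  fixes k l :: "'h::finite kernel"
  assumes "local_kernel k" "local_kernel l" "finite (supp v)"
  shows "app (kmult k l) v = app k (app l v)"
proof
  fix \<sigma>
  obtain F where F: "finite F" "insert \<sigma> (supp v) \<subseteq> F" "\<forall>n\<in>{k, l}. invariant n F"
    by (rule local_kernels_invariant[of "{k, l}" "insert \<sigma> (supp v)"]) (use assms in auto)
  then have inv: "invariant k F" "invariant l F" and sub: "supp v \<subseteq> F" "\<sigma> \<in> F" by auto
  have "app (kmult k l) v \<sigma> = (\<Sum>\<tau>\<in>F. (\<Sum>\<rho>\<in>F. k \<sigma> \<rho> * l \<rho> \<tau>) * v \<tau>)"
    using F(1) sub inv by (simp add: app_eq_sum kmult_eq_sum)
  also have "\<dots> = (\<Sum>\<rho>\<in>F. k \<sigma> \<rho> * (\<Sum>\<tau>\<in>F. l \<rho> \<tau> * v \<tau>))"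
    unfolding sum_distrib_left sum_distrib_right mult.assoc by (rule sum.swap)
  also have "\<dots> = app k (app l v) \<sigma>"
    using F(1) sub inv by (simp add: app_eq_sum[of F] supp_app)
  finally show "app (kmult k l) v \<sigma> = app k (app l v) \<sigma>" .
qed

lemma app_kadd:
  assumes "finite (supp v)"
  shows "app (kadd k l) v = (\<lambda>\<sigma>. app k v \<sigma> + app l v \<sigma>)"
  using assms by (simp add: app_eq_sum[of "supp v"] kadd_def fun_eq_iff ring_distribs sum.distrib)

lemma app_kscale: "app (kscale c k) v = (\<lambda>\<sigma>. c * app k v \<sigma>)"
  by (simp add: app_def kscale_def mult.assoc infsum_cmult_right' fun_eq_iff)

lemma app_scale: "app k (\<lambda>\<tau>. c * v \<tau>) = (\<lambda>\<sigma>. c * app k v \<sigma>)"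
  by (simp add: app_def mult.left_commute[of _ c] infsum_cmult_right' fun_eq_iff)

lemma l2_scale: "l2 (\<lambda>x. c * v x) = cmod c * l2 v"
  by (simp add: l2_def norm_mult power_mult_distrib infsum_cmult_right' real_sqrt_mult)

lemma l2_triangle:
  assumes "finite (supp v)" "finite (supp w)"
  shows "l2 (\<lambda>x. v x + w x) \<le> l2 v + l2 w"
proof -
  define F where "F = supp v \<union> supp w"
  have F: "finite F" "supp v \<subseteq> F" "supp w \<subseteq> F" "supp (\<lambda>x. v x + w x) \<subseteq> F"
    using assms by (auto simp: F_def supp_def)
  have "l2 (\<lambda>x. v x + w x) = L2_set (\<lambda>x. cmod (v x + w x)) F" using F by (simp add: l2_eq_L2_set)
  also have "\<dots> \<le> L2_set (\<lambda>x. cmod (v x) + cmod (w x)) F" by (rule L2_set_mono) (auto simp: norm_triangle_ineq)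
  also have "\<dots> \<le> L2_set (\<lambda>x. cmod (v x)) F + L2_set (\<lambda>x. cmod (w x)) F" by (rule L2_set_triangle_ineq)
  also have "\<dots> = l2 v + l2 w" using F by (simp add: l2_eq_L2_set)
  finally show ?thesis .
qed

lemma l2_eq_0D:
  assumes "finite (supp v)" "l2 v = 0"
  shows "v x = 0"
proof -
  have "\<forall>x\<in>supp v. cmod (v x) = 0"
    using assms L2_set_eq_0_iff[of "supp v" "\<lambda>x. cmod (v x)"] by (simp add: l2_eq_L2_set[of "supp v"])
  then show ?thesis by (auto simp: supp_def)
qed

section \<open>Uniform bounds on the entries and rows of a local kernel\<close>

lemma finite_range_local_kernel:
  fixes k :: "'h::finite kernel"
  assumes "local_kernel k"
  shows "finite {k \<sigma> \<tau> |\<sigma> \<tau>. True}"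
proof -
  from assms obtain \<Lambda> where \<Lambda>: "finite \<Lambda>" "local_on \<Lambda> k" by (auto simp: local_kernel_iff)
  define B :: "'h config set" where "B = block \<Lambda> (\<lambda>_. undefined)"
  have "{k \<sigma> \<tau> |\<sigma> \<tau>. True} \<subseteq> insert 0 ((\<lambda>(\<sigma>, \<tau>). k \<sigma> \<tau>) ` (B \<times> B))"
  proof clarify
    fix \<sigma> \<tau> assume notin: "k \<sigma> \<tau> \<notin> (\<lambda>(\<sigma>, \<tau>). k \<sigma> \<tau>) ` (B \<times> B)"
    show "k \<sigma> \<tau> = 0"
    proof (rule ccontr)
      assume "k \<sigma> \<tau> \<noteq> 0"
      then have eq: "\<And>i. i \<notin> \<Lambda> \<Longrightarrow> \<sigma> i = \<tau> i" using local_on_zero[OF \<Lambda>(2)] by blast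
      \<comment> \<open>Resetting the coordinates outside \<Lambda> to a fixed value does not change
        a nonzero entry, so the single block \<open>B\<close> already shows all of them.\<close>
      let ?r = "\<lambda>\<rho> i. if i \<in> \<Lambda> then \<rho> i else (undefined :: 'h)"
      have "k \<sigma> \<tau> = k (?r \<sigma>) (?r \<tau>)" by (rule local_on_cong[OF \<Lambda>(2)]) (auto simp: eq)
      moreover have "?r \<sigma> \<in> B" "?r \<tau> \<in> B" by (auto simp: B_def block_def)
      ultimately show False using notin by force
    qed
  qed
  moreover have "finite B" using \<Lambda>(1) by (simp add: B_def finite_block)
  ultimately show ?thesis by (meson finite_SigmaI finite_imageI finite_insert finite_subset)
qed

lemma card_block_le:
  fixes \<sigma> :: "'h::finite config"
  assumes "finite \<Lambda>"
  shows "card (block \<Lambda> \<sigma>) \<le> card (\<Lambda> \<rightarrow>\<^sub>E (UNIV :: 'h set))"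
  by (rule card_inj_on_le[OF inj_on_restrict_block]) (use assms in \<open>auto intro: finite_PiE\<close>)

text \<open>A row is supported on one block, and no block over \<Lambda> has more points than there
  are maps from \<Lambda> to \<open>'h\<close>, so the bound does not depend on \<sigma>.\<close>

lemma local_kernel_row_sums:
  fixes k :: "'h::finite kernel"
  assumes "local_kernel k"
  obtains C where "0 \<le> C" "\<And>\<sigma> F. finite F \<Longrightarrow> (\<Sum>\<tau>\<in>F. cmod (k \<sigma> \<tau>)) \<le> C"
proof -
  from assms obtain \<Lambda> where \<Lambda>: "finite \<Lambda>" "local_on \<Lambda> k" by (auto simp: local_kernel_iff)
  obtain M where M: "\<And>\<sigma> \<tau>. cmod (k \<sigma> \<tau>) \<le> M"
    using finite_imp_bounded[OF finite_range_local_kernel[OF assms]] unfolding bounded_iff by blast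
  have M0: "0 \<le> M" using M norm_ge_zero order_trans by blast
  define N where "N = card (\<Lambda> \<rightarrow>\<^sub>E (UNIV :: 'h set))"
  show ?thesis
  proof
    show "0 \<le> real N * M" using M0 by simp
    fix \<sigma> and F :: "'h config set" assume F: "finite F"
    have out: "k \<sigma> \<tau> = 0" if "\<tau> \<notin> block \<Lambda> \<sigma>" for \<tau>
    proof -
      from that obtain i where "i \<notin> \<Lambda>" "\<sigma> i \<noteq> \<tau> i" by (auto simp: block_def)
      then show ?thesis by (rule local_on_zero[OF \<Lambda>(2)])
    qed
    have "(\<Sum>\<tau>\<in>F. cmod (k \<sigma> \<tau>)) = (\<Sum>\<tau>\<in>F \<inter> block \<Lambda> \<sigma>. cmod (k \<sigma> \<tau>))"
      by (rule sum.mono_neutral_right) (use F out in auto)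
    also have "\<dots> \<le> (\<Sum>\<tau>\<in>block \<Lambda> \<sigma>. cmod (k \<sigma> \<tau>))"
      by (rule sum_mono2) (use finite_block[OF \<Lambda>(1)] in auto)
    also have "\<dots> \<le> real (card (block \<Lambda> \<sigma>)) * M" by (rule sum_bounded_above) (rule M)
    also have "\<dots> \<le> real N * M"
      unfolding N_def using card_block_le[OF \<Lambda>(1), of \<sigma>] M0 by (intro mult_right_mono) auto
    finally show "(\<Sum>\<tau>\<in>F. cmod (k \<sigma> \<tau>)) \<le> real N * M" .
  qed
qed

text \<open>Schur's test.\<close>
lemma local_kernel_bounded:
  fixes k :: "'h::finite kernel"
  assumes "local_kernel k"
  obtains C where "0 \<le> C" "\<And>v. finite (supp v) \<Longrightarrow> l2 (app k v) \<le> C * l2 v"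
proof -
  obtain C1 where C1: "0 \<le> C1" "\<And>\<sigma> F. finite F \<Longrightarrow> (\<Sum>\<tau>\<in>F. cmod (k \<sigma> \<tau>)) \<le> C1"
    using local_kernel_row_sums[OF assms] by blast
  \<comment> \<open>The rows of \<open>kstar k\<close> have the absolute values of the columns of
    \<open>k\<close>, so this bounds the column sums.\<close>
  obtain C2 where C2: "0 \<le> C2" "\<And>\<sigma> F. finite F \<Longrightarrow> (\<Sum>\<tau>\<in>F. cmod (kstar k \<sigma> \<tau>)) \<le> C2"
    using local_kernel_row_sums[OF local_kernel_kstar[OF assms]] by blast
  show ?thesis
  proof
    show "0 \<le> sqrt (C1 * C2)" using C1 C2 by simp
    fix v :: "'h config \<Rightarrow> complex" assume v: "finite (supp v)"
    obtain F where F: "finite F" "supp v \<subseteq> F" "\<forall>n\<in>{k}. invariant n F"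
      by (rule local_kernels_invariant[of "{k}" "supp v"]) (use assms v in auto)
    have row: "(cmod (app k v \<sigma>))\<^sup>2 \<le> C1 * (\<Sum>\<tau>\<in>F. cmod (k \<sigma> \<tau>) * (cmod (v \<tau>))\<^sup>2)" for \<sigma>
    proof -
      let ?a = "\<lambda>\<tau>. sqrt (cmod (k \<sigma> \<tau>))"
      have "cmod (app k v \<sigma>) \<le> (\<Sum>\<tau>\<in>F. cmod (k \<sigma> \<tau>) * cmod (v \<tau>))"
        using F by (simp add: app_eq_sum[of F] norm_mult[symmetric] norm_sum)
      also have "\<dots> = (\<Sum>\<tau>\<in>F. \<bar>?a \<tau>\<bar> * \<bar>?a \<tau> * cmod (v \<tau>)\<bar>)"
        by (intro sum.cong) (auto simp: abs_mult mult.assoc[symmetric])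
      also have "\<dots> \<le> L2_set ?a F * L2_set (\<lambda>\<tau>. ?a \<tau> * cmod (v \<tau>)) F" by (rule L2_set_mult_ineq)
      finally have "(cmod (app k v \<sigma>))\<^sup>2 \<le> (L2_set ?a F * L2_set (\<lambda>\<tau>. ?a \<tau> * cmod (v \<tau>)) F)\<^sup>2"
        by (rule power_mono) simp
      also have "\<dots> = (\<Sum>\<tau>\<in>F. cmod (k \<sigma> \<tau>)) * (\<Sum>\<tau>\<in>F. cmod (k \<sigma> \<tau>) * (cmod (v \<tau>))\<^sup>2)"
        by (simp add: power_mult_distrib L2_set_def sum_nonneg)
      also have "\<dots> \<le> C1 * (\<Sum>\<tau>\<in>F. cmod (k \<sigma> \<tau>) * (cmod (v \<tau>))\<^sup>2)"
        by (rule mult_right_mono[OF C1(2)[OF F(1)]]) (simp add: sum_nonneg)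
      finally show ?thesis .
    qed
    have "(\<Sum>\<sigma>\<in>F. (cmod (app k v \<sigma>))\<^sup>2) \<le> (\<Sum>\<sigma>\<in>F. C1 * (\<Sum>\<tau>\<in>F. cmod (k \<sigma> \<tau>) * (cmod (v \<tau>))\<^sup>2))"
      by (rule sum_mono) (rule row)
    also have "\<dots> = C1 * (\<Sum>\<tau>\<in>F. (\<Sum>\<sigma>\<in>F. cmod (kstar k \<tau> \<sigma>)) * (cmod (v \<tau>))\<^sup>2)"
      unfolding sum_distrib_left[symmetric] sum_distrib_right kstar_def complex_mod_cnj
      by (subst sum.swap) (rule refl)
    also have "\<dots> \<le> C1 * (\<Sum>\<tau>\<in>F. C2 * (cmod (v \<tau>))\<^sup>2)"
      by (intro mult_left_mono sum_mono mult_right_mono C2 C1 F) auto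
    also have "\<dots> = C1 * C2 * (\<Sum>\<tau>\<in>F. (cmod (v \<tau>))\<^sup>2)" by (simp add: sum_distrib_left mult.assoc)
    finally have "sqrt (\<Sum>\<sigma>\<in>F. (cmod (app k v \<sigma>))\<^sup>2) \<le> sqrt (C1 * C2) * sqrt (\<Sum>\<tau>\<in>F. (cmod (v \<tau>))\<^sup>2)"
      by (metis real_sqrt_le_mono real_sqrt_mult)
    then show "l2 (app k v) \<le> sqrt (C1 * C2) * l2 v"
      using F supp_app[of F v k] by (simp add: l2_eq_L2_set[of F] L2_set_def)
  qed
qed

lemma opnorm_eq: "opnorm k = Sup {l2 (app k v) |v. finite (supp v) \<and> l2 v \<le> 1}"
  by (simp add: opnorm_def l2_def app_def supp_def)

text \<open>A supremum of reals says nothing unless the set is bounded above, so Schur's test has to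
  come first. The inequality for arbitrary vectors then follows by normalising.\<close>

lemma opnorm_bound:
  fixes k :: "'h::finite kernel"
  assumes k: "local_kernel k" and v: "finite (supp v)"
  shows "l2 (app k v) \<le> opnorm k * l2 v"
proof (cases "l2 v = 0")
  case True
  then have "v = (\<lambda>_. 0)" using l2_eq_0D[OF v] by blast
  then show ?thesis by (simp add: app_def l2_def)
next
  case False
  then have pos: "0 < l2 v" using l2_nonneg[of v] by simp
  obtain C where C: "0 \<le> C" "\<And>v. finite (supp v) \<Longrightarrow> l2 (app k v) \<le> C * l2 v"
    using local_kernel_bounded[OF k] by blast
  let ?S = "{l2 (app k v) |v. finite (supp v) \<and> l2 v \<le> 1}"
  have bdd: "bdd_above ?S"
  proof (rule bdd_aboveI)
    fix x assume "x \<in> ?S"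
    then obtain v where "x = l2 (app k v)" "finite (supp v)" "l2 v \<le> 1" by blast
    then show "x \<le> C" using C(2)[of v] mult_left_mono[of "l2 v" 1 C] C(1) by simp
  qed
  define w where "w = (\<lambda>x. of_real (1 / l2 v) * v x)"
  have "l2 w = 1" unfolding w_def l2_scale using pos by (simp add: norm_divide)
  moreover have "finite (supp w)" by (rule finite_subset[OF _ v]) (auto simp: supp_def w_def)
  ultimately have "l2 (app k w) \<le> opnorm k"
    unfolding opnorm_eq by (intro cSup_upper[OF _ bdd]) auto
  moreover have "l2 (app k w) = l2 (app k v) / l2 v"
    unfolding w_def app_scale l2_scale using pos by (simp add: norm_divide)
  ultimately show ?thesis using pos by (simp add: pos_divide_le_eq)
qed

lemma opnorm_least:
  assumes "0 \<le> C" "\<And>v. finite (supp v) \<Longrightarrow> l2 (app k v) \<le> C * l2 v"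
  shows "opnorm k \<le> C"
  unfolding opnorm_eq
proof (rule cSup_least)
  have "l2 (app k (\<lambda>_. 0)) \<in> {l2 (app k v) |v. finite (supp v) \<and> l2 v \<le> 1}"
    by (auto simp: supp_def l2_def intro!: exI[of _ "\<lambda>_. 0"])
  then show "{l2 (app k v) |v. finite (supp v) \<and> l2 v \<le> 1} \<noteq> {}" by blast
next
  fix x assume "x \<in> {l2 (app k v) |v. finite (supp v) \<and> l2 v \<le> 1}"
  then obtain v where "x = l2 (app k v)" "finite (supp v)" "l2 v \<le> 1" by blast
  then show "x \<le> C" using assms(2)[of v] mult_left_mono[of "l2 v" 1 C] assms(1) by simp
qed

text \<open>Test vectors: applying a kernel to one of them reads off a column. This yields the
  definiteness of \<open>opnorm\<close> and the lower bound for the norm of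
  \<open>kone\<close>.\<close>

definition unit_vec :: "'x \<Rightarrow> 'x \<Rightarrow> complex" where
  "unit_vec x = (\<lambda>y. if y = x then 1 else 0)"

lemma supp_unit_vec: "supp (unit_vec x) = {x}"
  by (auto simp: supp_def unit_vec_def)

lemma l2_unit_vec: "l2 (unit_vec x) = 1"
  by (simp add: l2_eq_L2_set[of "{x}"] supp_unit_vec L2_set_def) (simp add: unit_vec_def)

lemma app_unit_vec: "app k (unit_vec \<tau>) = (\<lambda>\<sigma>. k \<sigma> \<tau>)"
  by (simp add: app_eq_sum[of "{\<tau>}"] supp_unit_vec fun_eq_iff) (simp add: unit_vec_def)

lemma opnorm_nonneg:
  fixes k :: "'h::finite kernel"
  assumes "local_kernel k"
  shows "0 \<le> opnorm k"
  using opnorm_bound[OF assms, of "unit_vec undefined"] l2_nonneg[of "app k (unit_vec undefined)"]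
  by (simp add: supp_unit_vec l2_unit_vec)

lemma opnorm_eq_0D:
  fixes k :: "'h::finite kernel"
  assumes "local_kernel k" "opnorm k = 0"
  shows "k = kzero"
proof (intro ext)
  fix \<sigma> \<tau>
  have fin: "finite (supp (app k (unit_vec \<tau>)))"
    by (rule finite_supp_app[OF assms(1)]) (simp add: supp_unit_vec)
  have "l2 (app k (unit_vec \<tau>)) = 0"
    using opnorm_bound[OF assms(1), of "unit_vec \<tau>"] assms(2) l2_nonneg[of "app k (unit_vec \<tau>)"]
    by (simp add: supp_unit_vec)
  from l2_eq_0D[OF fin this] show "k \<sigma> \<tau> = kzero \<sigma> \<tau>" by (simp add: app_unit_vec kzero_def)
qed

lemma opnorm_kadd:
  fixes k l :: "'h::finite kernel"
  assumes k: "local_kernel k" and l: "local_kernel l"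
  shows "opnorm (kadd k l) \<le> opnorm k + opnorm l"
proof (rule opnorm_least)
  show "0 \<le> opnorm k + opnorm l" using opnorm_nonneg[OF k] opnorm_nonneg[OF l] by simp
  fix v :: "'h config \<Rightarrow> complex" assume v: "finite (supp v)"
  have "l2 (app (kadd k l) v) \<le> l2 (app k v) + l2 (app l v)"
    unfolding app_kadd[OF v] by (intro l2_triangle finite_supp_app k l v)
  also have "\<dots> \<le> (opnorm k + opnorm l) * l2 v"
    using opnorm_bound[OF k v] opnorm_bound[OF l v] by (simp add: distrib_right)
  finally show "l2 (app (kadd k l) v) \<le> (opnorm k + opnorm l) * l2 v" .
qed

lemma opnorm_kscale_le:
  fixes k :: "'h::finite kernel"
  assumes k: "local_kernel k"
  shows "opnorm (kscale c k) \<le> cmod c * opnorm k"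
proof (rule opnorm_least)
  fix v :: "'h config \<Rightarrow> complex" assume v: "finite (supp v)"
  show "l2 (app (kscale c k) v) \<le> cmod c * opnorm k * l2 v"
    unfolding app_kscale l2_scale using opnorm_bound[OF k v] by (simp add: mult_left_mono mult.assoc)
qed (simp add: opnorm_nonneg[OF k])

lemma opnorm_kscale:
  fixes k :: "'h::finite kernel"
  assumes k: "local_kernel k"
  shows "opnorm (kscale c k) = cmod c * opnorm k"
proof (cases "c = 0")
  case True
  then show ?thesis
    using opnorm_kscale_le[OF k, of c] opnorm_nonneg[OF local_kernel_kscale[OF k, of c]] by simp
next
  case False
  \<comment> \<open>The reverse inequality is the first one applied to the inverse scalar.\<close>
  have "kscale (1 / c) (kscale c k) = k" using False by (simp add: kscale_def)
  then have "opnorm k \<le> cmod (1 / c) * opnorm (kscale c k)"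
    using opnorm_kscale_le[OF local_kernel_kscale[OF k, of c], of "1 / c"] by simp
  then have "cmod c * opnorm k \<le> opnorm (kscale c k)"
    using False by (simp add: norm_divide field_simps)
  then show ?thesis using opnorm_kscale_le[OF k, of c] by simp
qed

lemma opnorm_kmult:
  fixes k l :: "'h::finite kernel"
  assumes k: "local_kernel k" and l: "local_kernel l"
  shows "opnorm (kmult k l) \<le> opnorm k * opnorm l"
proof (rule opnorm_least)
  show "0 \<le> opnorm k * opnorm l" using opnorm_nonneg[OF k] opnorm_nonneg[OF l] by simp
  fix v :: "'h config \<Rightarrow> complex" assume v: "finite (supp v)"
  have "l2 (app (kmult k l) v) \<le> opnorm k * l2 (app l v)"
    unfolding app_kmult[OF k l v] by (intro opnorm_bound[OF k] finite_supp_app[OF l v])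
  also have "\<dots> \<le> opnorm k * (opnorm l * l2 v)"
    by (intro mult_left_mono opnorm_bound[OF l v] opnorm_nonneg[OF k])
  finally show "l2 (app (kmult k l) v) \<le> opnorm k * opnorm l * l2 v" by (simp add: mult.assoc)
qed

lemma opnorm_kone: "opnorm (kone :: 'h::finite kernel) = 1"
proof (rule antisym)
  have app1: "app (kone :: 'h kernel) v = v" for v
  proof
    fix \<sigma>
    have "app (kone :: 'h kernel) v \<sigma> = (\<Sum>\<tau>\<in>{\<sigma>}. kone \<sigma> \<tau> * v \<tau>)"
      unfolding app_def by (rule infsum_eq_sum) (auto simp: kone_def)
    then show "app kone v \<sigma> = v \<sigma>" by (simp add: kone_def)
  qed
  show "opnorm (kone :: 'h kernel) \<le> 1" by (rule opnorm_least) (auto simp: app1)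
  show "1 \<le> opnorm (kone :: 'h kernel)"
    using opnorm_bound[OF local_kernel_kone, of "unit_vec (undefined :: 'h config)"]
    by (simp add: app1 supp_unit_vec l2_unit_vec)
qed

lemma kstar_kstar: "kstar (kstar k) = k"
  by (simp add: kstar_def)

text \<open>With \<open>w = k\<^sup>* v\<close>, the Cauchy--Schwarz inequality gives
  \<open>\<parallel>w\<parallel>\<^sup>2 = \<langle>v, k w\<rangle> \<le> \<parallel>v\<parallel> \<parallel>k\<parallel> \<parallel>w\<parallel>\<close>.\<close>
lemma opnorm_kstar_le:
  fixes k :: "'h::finite kernel"
  assumes k: "local_kernel k"
  shows "opnorm (kstar k) \<le> opnorm k"
proof (rule opnorm_least[OF opnorm_nonneg[OF k]])
  fix v :: "'h config \<Rightarrow> complex" assume v: "finite (supp v)"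
  have k': "local_kernel (kstar k)" using k by (rule local_kernel_kstar)
  obtain F where F: "finite F" "supp v \<subseteq> F" "\<forall>n\<in>{k, kstar k}. invariant n F"
    by (rule local_kernels_invariant[of "{k, kstar k}" "supp v"]) (use k k' v in auto)
  define w where "w = app (kstar k) v"
  have w: "supp w \<subseteq> F" "finite (supp w)"
    using F supp_app[of F v "kstar k"] finite_subset[of _ F] by (auto simp: w_def)
  have kw: "supp (app k w) \<subseteq> F" using F w supp_app[of F w k] by simp
  have "complex_of_real ((l2 w)\<^sup>2) = (\<Sum>\<sigma>\<in>F. w \<sigma> * cnj (w \<sigma>))"
    using F(1) w by (simp add: l2_eq_L2_set[of F] L2_set_def sum_nonneg complex_mult_cnj cmod_power2)
  also have "\<dots> = (\<Sum>\<sigma>\<in>F. (\<Sum>\<tau>\<in>F. cnj (k \<tau> \<sigma>) * v \<tau>) * cnj (w \<sigma>))"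
    unfolding w_def using F by (simp add: app_eq_sum[of F v] kstar_def)
  also have "\<dots> = (\<Sum>\<tau>\<in>F. v \<tau> * cnj (\<Sum>\<sigma>\<in>F. k \<tau> \<sigma> * w \<sigma>))"
    unfolding sum_distrib_left sum_distrib_right cnj_sum
    by (subst sum.swap) (simp add: mult_ac)
  also have "\<dots> = (\<Sum>\<tau>\<in>F. v \<tau> * cnj (app k w \<tau>))"
    using F w by (simp add: app_eq_sum[of F w])
  finally have "(l2 w)\<^sup>2 = cmod (\<Sum>\<tau>\<in>F. v \<tau> * cnj (app k w \<tau>))"
    by (metis abs_of_nonneg norm_of_real zero_le_power2)
  also have "\<dots> \<le> (\<Sum>\<tau>\<in>F. cmod (v \<tau>) * cmod (app k w \<tau>))"
    by (rule order_trans[OF norm_sum]) (simp add: norm_mult)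
  also have "\<dots> \<le> l2 v * l2 (app k w)"
    using L2_set_mult_ineq[of "\<lambda>\<tau>. cmod (v \<tau>)" "\<lambda>\<tau>. cmod (app k w \<tau>)" F] F kw
    by (simp add: l2_eq_L2_set[of F])
  also have "\<dots> \<le> l2 v * (opnorm k * l2 w)"
    by (intro mult_left_mono opnorm_bound[OF k w(2)] l2_nonneg)
  finally have "l2 w * l2 w \<le> (opnorm k * l2 v) * l2 w" by (simp add: power2_eq_square mult_ac)
  then show "l2 (app (kstar k) v) \<le> opnorm k * l2 v"
    unfolding w_def[symmetric]
    using l2_nonneg[of w] l2_nonneg[of v] opnorm_nonneg[OF k] mult_le_cancel_right[of "l2 w" "l2 w" "opnorm k * l2 v"]
    by (cases "l2 w = 0") auto
qed

lemma opnorm_kstar: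
  fixes k :: "'h::finite kernel"
  assumes k: "local_kernel k"
  shows "opnorm (kstar k) = opnorm k"
  using opnorm_kstar_le[OF k] opnorm_kstar_le[OF local_kernel_kstar[OF k]] by (simp add: kstar_kstar)

section \<open>The normed algebra of local kernels\<close>

text \<open>A type of its own makes the local observables an instance of
  \<open>real_normed_algebra_1\<close>, so that the general theory of Cauchy sequences and limits
  applies to them.\<close>

typedef 'h lker = "{k :: 'h kernel. local_kernel k}"
  morphisms kernel_of Lker
  using local_kernel_kone by blast

setup_lifting type_definition_lker

lemma local_kernel_kernel_of [simp]: "local_kernel (kernel_of a)"
  using kernel_of[of a] by simp

instantiation lker :: (finite) real_normed_algebra_1
begin

lift_definition zero_lker :: "'a lker" is kzero by (rule local_kernel_kzero)
lift_definition one_lker :: "'a lker" is kone by (rule local_kernel_kone)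
lift_definition plus_lker :: "'a lker \<Rightarrow> 'a lker \<Rightarrow> 'a lker" is kadd by (rule local_kernel_kadd)
lift_definition minus_lker :: "'a lker \<Rightarrow> 'a lker \<Rightarrow> 'a lker" is kdiff by (rule local_kernel_kdiff)
lift_definition uminus_lker :: "'a lker \<Rightarrow> 'a lker" is "kscale (-1)" by (rule local_kernel_kscale)
lift_definition times_lker :: "'a lker \<Rightarrow> 'a lker \<Rightarrow> 'a lker" is kmult by (rule local_kernel_kmult)
lift_definition scaleR_lker :: "real \<Rightarrow> 'a lker \<Rightarrow> 'a lker" is "\<lambda>r. kscale (of_real r)"
  by (rule local_kernel_kscale)
lift_definition norm_lker :: "'a lker \<Rightarrow> real" is opnorm .

definition dist_lker :: "'a lker \<Rightarrow> 'a lker \<Rightarrow> real" where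
  "dist_lker a b = norm (a - b)"

definition [code del]:
  "(uniformity :: ('a lker \<times> 'a lker) filter) = (INF e\<in>{0 <..}. principal {(x, y). dist x y < e})"

definition open_lker :: "'a lker set \<Rightarrow> bool" where
  [code del]: "open_lker S = (\<forall>x\<in>S. \<forall>\<^sub>F (x', y) in uniformity. x' = x \<longrightarrow> y \<in> S)"

definition sgn_lker :: "'a lker \<Rightarrow> 'a lker" where
  "sgn_lker a = inverse (norm a) *\<^sub>R a"

instance
proof
  fix a b c :: "'a lker" and r s :: real
  show "a + b + c = a + (b + c)" "a + b = b + a" "0 + a = a" "- a + a = 0" "a - b = a + - b"
    "r *\<^sub>R (a + b) = r *\<^sub>R a + r *\<^sub>R b" "(r + s) *\<^sub>R a = r *\<^sub>R a + s *\<^sub>R a"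
    "r *\<^sub>R s *\<^sub>R a = (r * s) *\<^sub>R a" "1 *\<^sub>R a = a"
    by (transfer, simp add: kadd_def kdiff_def kscale_def kzero_def fun_eq_iff ring_distribs)+
  show "a * b * c = a * (b * c)" by transfer (rule kmult_assoc)
  show "(a + b) * c = a * c + b * c" by transfer (rule kmult_kadd_left)
  show "a * (b + c) = a * b + a * c" by transfer (rule kmult_kadd_right)
  show "1 * a = a" by transfer (rule kmult_kone_left)
  show "a * 1 = a" by transfer (rule kmult_kone_right)
  show "r *\<^sub>R a * b = r *\<^sub>R (a * b)" by transfer (rule kmult_kscale_left)
  show "a * r *\<^sub>R b = r *\<^sub>R (a * b)" by transfer (rule kmult_kscale_right)
  show "(0 :: 'a lker) \<noteq> 1"
    by transfer (auto simp: kzero_def kone_def fun_eq_iff)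
  show "sgn a = inverse (norm a) *\<^sub>R a" by (rule sgn_lker_def)
  show "dist a b = norm (a - b)" by (rule dist_lker_def)
  show "(uniformity :: ('a lker \<times> 'a lker) filter) = (INF e\<in>{0 <..}. principal {(x, y). dist x y < e})"
    by (rule uniformity_lker_def)
  show "open S = (\<forall>x\<in>S. \<forall>\<^sub>F (x', y) in uniformity. x' = x \<longrightarrow> y \<in> S)" for S :: "'a lker set"
    by (rule open_lker_def)
  show norm_scaleR: "norm (r *\<^sub>R a) = \<bar>r\<bar> * norm a" for r and a :: "'a lker"
    by transfer (simp add: opnorm_kscale)
  show "norm a = 0 \<longleftrightarrow> a = 0"
  proof
    show "norm a = 0 \<Longrightarrow> a = 0" by transfer (rule opnorm_eq_0D)
    show "a = 0 \<Longrightarrow> norm a = 0"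
      using norm_scaleR[of 0 a]
      by transfer (simp add: kscale_def kzero_def)
  qed
  show "norm (a + b) \<le> norm a + norm b" by transfer (rule opnorm_kadd)
  show "norm (a * b) \<le> norm a * norm b" by transfer (rule opnorm_kmult)
  show "norm (1 :: 'a lker) = 1" by transfer (rule opnorm_kone)
qed

end

text \<open>The type class provides real scalars only; complex scalars and the star are carried
  alongside, here and again on the completion.\<close>

lift_definition lscale :: "complex \<Rightarrow> 'h::finite lker \<Rightarrow> 'h lker" is kscale by (rule local_kernel_kscale)
lift_definition lstar :: "'h::finite lker \<Rightarrow> 'h lker" is kstar by (rule local_kernel_kstar)

lemma lscale_simps:
  fixes a b :: "'h::finite lker"
  shows "lscale c (a + b) = lscale c a + lscale c b"
    and "lscale c (a - b) = lscale c a - lscale c b"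
    and "lscale (c + d) a = lscale c a + lscale d a"
    and "lscale c (lscale d a) = lscale (c * d) a"
    and "lscale 1 a = a" "lscale (of_real r) a = r *\<^sub>R a"
    and "lscale c a * b = lscale c (a * b)" "a * lscale c b = lscale c (a * b)"
    and "norm (lscale c a) = cmod c * norm a"
  subgoal by transfer (simp add: kadd_def kscale_def fun_eq_iff ring_distribs)
  subgoal by transfer (simp add: kdiff_def kscale_def fun_eq_iff ring_distribs)
  subgoal by transfer (simp add: kadd_def kscale_def fun_eq_iff ring_distribs)
  subgoal by transfer (simp add: kscale_def fun_eq_iff)
  subgoal by transfer (simp add: kscale_def)
  subgoal by transfer (rule refl)
  subgoal by transfer (rule kmult_kscale_left)
  subgoal by transfer (rule kmult_kscale_right)
  subgoal by transfer (rule opnorm_kscale)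
  done

lemma lscale_minus_one: "lscale (-1) a = - (a :: 'h::finite lker)"
  by transfer (rule refl)

lemma lstar_simps:
  fixes a b :: "'h::finite lker"
  shows "lstar (a + b) = lstar a + lstar b" "lstar (a - b) = lstar a - lstar b"
    and "lstar (lscale c a) = lscale (cnj c) (lstar a)"
    and "lstar 1 = (1 :: 'h lker)" "lstar (lstar a) = a"
  subgoal by transfer (simp add: kadd_def kstar_def)
  subgoal by transfer (simp add: kdiff_def kstar_def)
  subgoal by transfer (simp add: kscale_def kstar_def)
  subgoal by transfer (auto simp: kone_def kstar_def fun_eq_iff)
  subgoal by transfer (rule kstar_kstar)
  done

lemma lstar_mult: "lstar (a * b) = lstar b * lstar (a :: 'h::finite lker)"
  by transfer (rule kstar_kmult)

lemma norm_lstar: "norm (lstar a) = norm (a :: 'h::finite lker)"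
  by transfer (rule opnorm_kstar)

section \<open>The quasi-local algebra as a Banach algebra\<close>

text \<open>One estimate for all operations: sums, differences, products, complex multiples and
  stars of Cauchy sequences differ only in the constants \<open>K\<close> and
  \<open>L\<close>.\<close>

lemma Cauchy_dominated:
  fixes U V W :: "nat \<Rightarrow> 'x::real_normed_vector"
  assumes "Cauchy U" "Cauchy V"
    and le: "\<And>m n. norm (W m - W n) \<le> K * norm (U m - U n) + L * norm (V m - V n)"
  shows "Cauchy W"
proof (rule CauchyI)
  fix e :: real assume e: "0 < e"
  \<comment> \<open>The entry 1 keeps \<open>M\<close> positive, so that division by it is possible
    whatever \<open>K\<close> and \<open>L\<close> are.\<close>
  define M where "M = max 1 (max K L)"
  have M: "0 < M" "K \<le> M" "L \<le> M" by (auto simp: M_def)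
  define d where "d = e / (2 * M)"
  have d: "0 < d" using e M by (simp add: d_def)
  obtain m1 where m1: "\<And>m n. m1 \<le> m \<Longrightarrow> m1 \<le> n \<Longrightarrow> norm (U m - U n) < d"
    using CauchyD[OF assms(1) d] by blast
  obtain m2 where m2: "\<And>m n. m2 \<le> m \<Longrightarrow> m2 \<le> n \<Longrightarrow> norm (V m - V n) < d"
    using CauchyD[OF assms(2) d] by blast
  show "\<exists>N. \<forall>m\<ge>N. \<forall>n\<ge>N. norm (W m - W n) < e"
  proof (intro exI allI impI)
    fix m n assume mn: "max m1 m2 \<le> m" "max m1 m2 \<le> n"
    have "norm (W m - W n) \<le> K * norm (U m - U n) + L * norm (V m - V n)" by (rule le)
    also have "\<dots> \<le> M * norm (U m - U n) + M * norm (V m - V n)"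
      using M by (intro add_mono mult_right_mono) auto
    also have "\<dots> < M * d + M * d"
      using M mn m1[of m n] m2[of m n] by (intro add_strict_mono mult_strict_left_mono) auto
    also have "\<dots> = e" using M by (simp add: d_def)
    finally show "norm (W m - W n) < e" .
  qed
qed

lemma Cauchy_add:
  fixes U V :: "nat \<Rightarrow> 'x::real_normed_vector"
  assumes "Cauchy U" "Cauchy V"
  shows "Cauchy (\<lambda>n. U n + V n)"
proof (rule Cauchy_dominated[OF assms])
  fix m n show "norm (U m + V m - (U n + V n)) \<le> 1 * norm (U m - U n) + 1 * norm (V m - V n)"
    using norm_triangle_ineq[of "U m - U n" "V m - V n"] by (simp add: algebra_simps)
qed

lemma Cauchy_diff:
  fixes U V :: "nat \<Rightarrow> 'x::real_normed_vector"
  assumes "Cauchy U" "Cauchy V"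
  shows "Cauchy (\<lambda>n. U n - V n)"
proof (rule Cauchy_dominated[OF assms])
  fix m n show "norm (U m - V m - (U n - V n)) \<le> 1 * norm (U m - U n) + 1 * norm (V m - V n)"
    using norm_triangle_ineq4[of "U m - U n" "V m - V n"] by (simp add: algebra_simps)
qed

lemma Cauchy_mult:
  fixes U V :: "nat \<Rightarrow> 'x::real_normed_algebra"
  assumes "Cauchy U" "Cauchy V"
  shows "Cauchy (\<lambda>n. U n * V n)"
proof -
  obtain K where K: "\<And>n. norm (U n) \<le> K" using Cauchy_Bseq[OF assms(1)] unfolding Bseq_def by blast
  obtain L where L: "\<And>n. norm (V n) \<le> L" using Cauchy_Bseq[OF assms(2)] unfolding Bseq_def by blast
  show ?thesis
  proof (rule Cauchy_dominated[OF assms])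
    fix m n
    have "U m * V m - U n * V n = (U m - U n) * V m + U n * (V m - V n)" by (simp add: algebra_simps)
    also have "norm \<dots> \<le> norm (U m - U n) * norm (V m) + norm (U n) * norm (V m - V n)"
      by (intro order_trans[OF norm_triangle_ineq] add_mono norm_mult_ineq)
    also have "\<dots> \<le> L * norm (U m - U n) + K * norm (V m - V n)"
      using mult_right_mono[OF L[of m], of "norm (U m - U n)"]
        mult_right_mono[OF K[of n], of "norm (V m - V n)"] by (simp add: mult.commute)
    finally show "norm (U m * V m - U n * V n) \<le> L * norm (U m - U n) + K * norm (V m - V n)" .
  qed
qed

lemma Cauchy_lscale:
  assumes "Cauchy U" shows "Cauchy (\<lambda>n. lscale c (U n))"
  by (rule Cauchy_dominated[OF assms assms, of _ "cmod c" 0]) (simp add: lscale_simps flip: lscale_simps(2))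

lemma Cauchy_lstar:
  assumes "Cauchy U" shows "Cauchy (\<lambda>n. lstar (U n))"
  by (rule Cauchy_dominated[OF assms assms, of _ 1 0]) (simp add: norm_lstar flip: lstar_simps(2))

lemma Cauchy_const: "Cauchy (\<lambda>_. a :: 'x::real_normed_vector)"
  by (rule CauchyI) auto

text \<open>\<open>qlim\<close> and \<open>rep\<close> are \<open>qof\<close> and
  \<open>rep_seq\<close> with the sequences moved to the type \<open>lker\<close>, where Cauchy
  sequences and null sequences have their usual class-based meaning.\<close>

definition qlim :: "(nat \<Rightarrow> 'h::finite lker) \<Rightarrow> 'h qloc" where
  "qlim U = qof (\<lambda>n. kernel_of (U n))"

definition rep :: "'h::finite qloc \<Rightarrow> nat \<Rightarrow> 'h lker" where
  "rep x n = Lker (rep_seq x n)"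

lemma opnorm_kdiff_kernel_of: "opnorm (kdiff (kernel_of a) (kernel_of b)) = norm (a - b)"
  by transfer (rule refl)

lemma kcauchy_kernel_of: "kcauchy (\<lambda>n. kernel_of (U n)) \<longleftrightarrow> Cauchy U"
  by (simp add: kcauchy_def Cauchy_iff opnorm_kdiff_kernel_of)

lemma kcauchy_obtain:
  assumes "kcauchy (u :: nat \<Rightarrow> 'h::finite kernel)"
  obtains U where "Cauchy U" "u = (\<lambda>n. kernel_of (U n))"
proof
  have "local_kernel (u n)" for n using assms by (simp add: kcauchy_def)
  then show eq: "u = (\<lambda>n. kernel_of (Lker (u n)))" by (simp add: Lker_inverse)
  show "Cauchy (\<lambda>n. Lker (u n))" using assms eq kcauchy_kernel_of by metis
qed

lemma kernel_of_in_kcls: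
  "(\<lambda>n. kernel_of (V n)) \<in> kcls (\<lambda>n. kernel_of (U n)) \<longleftrightarrow> Cauchy V \<and> (\<lambda>n. U n - V n) \<longlonglongrightarrow> 0"
  by (simp add: kcls_def kcauchy_kernel_of opnorm_kdiff_kernel_of tendsto_norm_zero_iff)

text \<open>Having a null difference is an equivalence relation on Cauchy sequences, and
  \<open>kcls\<close> forms its classes.\<close>

lemma kcls_eq_iff:
  fixes U V :: "nat \<Rightarrow> 'h::finite lker"
  assumes "Cauchy U" "Cauchy V"
  shows "kcls (\<lambda>n. kernel_of (U n)) = kcls (\<lambda>n. kernel_of (V n)) \<longleftrightarrow> (\<lambda>n. U n - V n) \<longlonglongrightarrow> 0"
proof
  assume eq: "kcls (\<lambda>n. kernel_of (U n)) = kcls (\<lambda>n. kernel_of (V n))"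
  have "(\<lambda>n. kernel_of (V n)) \<in> kcls (\<lambda>n. kernel_of (V n))"
    using assms by (simp add: kernel_of_in_kcls)
  then show "(\<lambda>n. U n - V n) \<longlonglongrightarrow> 0" using eq kernel_of_in_kcls by blast
next
  have sub: "kcls (\<lambda>n. kernel_of (U n)) \<subseteq> kcls (\<lambda>n. kernel_of (V n))"
    if lim: "(\<lambda>n. U n - V n) \<longlonglongrightarrow> 0" for U V :: "nat \<Rightarrow> 'h lker"
  proof
    fix w assume w: "w \<in> kcls (\<lambda>n. kernel_of (U n))"
    then have "kcauchy w" by (simp add: kcls_def)
    then obtain W where W: "Cauchy W" "w = (\<lambda>n. kernel_of (W n))" by (rule kcauchy_obtain)
    with w have "(\<lambda>n. U n - W n) \<longlonglongrightarrow> 0" by (simp add: kernel_of_in_kcls)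
    from tendsto_diff[OF this lim] have "(\<lambda>n. V n - W n) \<longlonglongrightarrow> 0" by simp
    then show "w \<in> kcls (\<lambda>n. kernel_of (V n))" using W by (simp add: kernel_of_in_kcls)
  qed
  assume lim: "(\<lambda>n. U n - V n) \<longlonglongrightarrow> 0"
  from tendsto_minus[OF lim] have lim': "(\<lambda>n. V n - U n) \<longlonglongrightarrow> 0" by simp
  show "kcls (\<lambda>n. kernel_of (U n)) = kcls (\<lambda>n. kernel_of (V n))"
    using sub[OF lim] sub[OF lim'] by (rule subset_antisym)
qed

lemma Rep_qlim: "Cauchy U \<Longrightarrow> Rep_qloc (qlim U) = kcls (\<lambda>n. kernel_of (U n))"
  unfolding qlim_def qof_def using kcauchy_kernel_of by (intro Abs_qloc_inverse) blast

lemma qlim_eq_iff: "Cauchy U \<Longrightarrow> Cauchy V \<Longrightarrow> qlim U = qlim V \<longleftrightarrow> (\<lambda>n. U n - V n) \<longlonglongrightarrow> 0"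
  by (metis Rep_qlim Rep_qloc_inject kcls_eq_iff)

text \<open>The choice in \<open>rep_seq\<close> returns an unknown member of the class, which is
  nonempty because it contains U itself; all that survives is that the difference from U tends to
  0.\<close>

lemma rep_seq_qlim:
  assumes "Cauchy U"
  obtains V where "Cauchy V" "rep_seq (qlim U) = (\<lambda>n. kernel_of (V n))" "(\<lambda>n. U n - V n) \<longlonglongrightarrow> 0"
proof -
  have "(\<lambda>n. kernel_of (U n)) \<in> kcls (\<lambda>n. kernel_of (U n))"
    using assms by (simp add: kernel_of_in_kcls)
  then have *: "rep_seq (qlim U) \<in> kcls (\<lambda>n. kernel_of (U n))"
    unfolding rep_seq_def Rep_qlim[OF assms] by (rule someI[of "\<lambda>u. u \<in> _"])
  then have "kcauchy (rep_seq (qlim U))" by (simp add: kcls_def)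
  then obtain V where "Cauchy V" "rep_seq (qlim U) = (\<lambda>n. kernel_of (V n))" by (rule kcauchy_obtain)
  with * show ?thesis using that by (simp add: kernel_of_in_kcls)
qed

lemma qloc_cases:
  fixes x :: "'h::finite qloc"
  obtains U where "Cauchy U" "x = qlim U"
proof (cases x)
  case (Abs_qloc C)
  then obtain u where u: "kcauchy u" "C = kcls u" by blast
  obtain U where "Cauchy U" "u = (\<lambda>n. kernel_of (U n))" by (rule kcauchy_obtain[OF u(1)])
  then show ?thesis using that Abs_qloc(1) u(2) by (simp add: qlim_def qof_def)
qed

lemma rep_seq_eq: "rep_seq x n = kernel_of (rep x n)"
  and Cauchy_rep: "Cauchy (rep x)"
  and qlim_rep: "qlim (rep x) = x"
proof -
  obtain U where U: "Cauchy U" "x = qlim U" by (rule qloc_cases)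
  obtain V where V: "Cauchy V" "rep_seq x = (\<lambda>n. kernel_of (V n))" "(\<lambda>n. U n - V n) \<longlonglongrightarrow> 0"
    using rep_seq_qlim[OF U(1)] U(2) by metis
  have eq: "rep x = V" by (simp add: rep_def V(2) kernel_of_inverse fun_eq_iff)
  show "rep_seq x n = kernel_of (rep x n)" "Cauchy (rep x)" by (simp_all add: V eq)
  have "qlim V = x" using qlim_eq_iff[OF U(1) V(1)] V(3) U(2) by simp
  then show "qlim (rep x) = x" by (simp only: eq)
qed

lemma rep_qlim: "Cauchy U \<Longrightarrow> (\<lambda>n. rep (qlim U) n - U n) \<longlonglongrightarrow> 0"
  using qlim_eq_iff[OF Cauchy_rep, of U "qlim U"] qlim_rep by blast

text \<open>The operations are defined on the chosen representatives. This lemma and its analogues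
  for the other operations and the norm show that arbitrary Cauchy representatives give the same
  result; after them the choice plays no part in any argument.\<close>

lemma qadd_qlim:
  assumes "Cauchy U" "Cauchy V"
  shows "qadd (qlim U) (qlim V) = qlim (\<lambda>n. U n + V n)"
proof -
  have "qadd (qlim U) (qlim V) = qlim (\<lambda>n. rep (qlim U) n + rep (qlim V) n)"
    unfolding qadd_def qlim_def[of "\<lambda>n. _ n + _ n"] by (simp add: rep_seq_eq plus_lker.rep_eq)
  also have "\<dots> = qlim (\<lambda>n. U n + V n)"
    using tendsto_add[OF rep_qlim[OF assms(1)] rep_qlim[OF assms(2)]]
    by (subst qlim_eq_iff) (simp_all add: assms Cauchy_add Cauchy_rep add_diff_add)
  finally show ?thesis .
qed

lemma qdiff_qlim:
  assumes "Cauchy U" "Cauchy V"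
  shows "qdiff (qlim U) (qlim V) = qlim (\<lambda>n. U n - V n)"
proof -
  have eq: "rep (qlim U) n - rep (qlim V) n - (U n - V n)
      = (rep (qlim U) n - U n) - (rep (qlim V) n - V n)" for n by simp
  have "qdiff (qlim U) (qlim V) = qlim (\<lambda>n. rep (qlim U) n - rep (qlim V) n)"
    unfolding qdiff_def qlim_def[of "\<lambda>n. _ n - _ n"] by (simp add: rep_seq_eq minus_lker.rep_eq)
  also have "\<dots> = qlim (\<lambda>n. U n - V n)"
    using tendsto_diff[OF rep_qlim[OF assms(1)] rep_qlim[OF assms(2)]]
    by (subst qlim_eq_iff) (simp_all add: assms Cauchy_diff Cauchy_rep eq)
  finally show ?thesis .
qed

lemma qmult_qlim:
  assumes "Cauchy U" "Cauchy V"
  shows "qmult (qlim U) (qlim V) = qlim (\<lambda>n. U n * V n)"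
proof -
  let ?R = "rep (qlim U)" and ?S = "rep (qlim V)"
  \<comment> \<open>\<open>R S - U V = (R - U) S + U (S - V)\<close>, and each summand is a null
    sequence times a bounded one.\<close>
  have "(\<lambda>n. (?R n - U n) * ?S n) \<longlonglongrightarrow> 0"
    using bounded_bilinear.Zfun_prod_Bfun[OF bounded_bilinear_mult _ Cauchy_Bseq[OF Cauchy_rep]]
      rep_qlim[OF assms(1)] by (simp add: tendsto_Zfun_iff)
  moreover have "(\<lambda>n. U n * (?S n - V n)) \<longlonglongrightarrow> 0"
    using bounded_bilinear.Bfun_prod_Zfun[OF bounded_bilinear_mult Cauchy_Bseq[OF assms(1)]]
      rep_qlim[OF assms(2)] by (simp add: tendsto_Zfun_iff)
  ultimately have "(\<lambda>n. (?R n - U n) * ?S n + U n * (?S n - V n)) \<longlonglongrightarrow> 0 + 0"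
    by (rule tendsto_add)
  then have lim: "(\<lambda>n. ?R n * ?S n - U n * V n) \<longlonglongrightarrow> 0"
    by (simp add: left_diff_distrib right_diff_distrib)
  have "qmult (qlim U) (qlim V) = qlim (\<lambda>n. ?R n * ?S n)"
    unfolding qmult_def qlim_def[of "\<lambda>n. _ n * _ n"] by (simp add: rep_seq_eq times_lker.rep_eq)
  also have "\<dots> = qlim (\<lambda>n. U n * V n)"
    using lim by (subst qlim_eq_iff) (simp_all add: assms Cauchy_mult Cauchy_rep)
  finally show ?thesis .
qed

lemma qscale_qlim:
  assumes "Cauchy U"
  shows "qscale c (qlim U) = qlim (\<lambda>n. lscale c (U n))"
proof -
  have lim: "(\<lambda>n. lscale c (rep (qlim U) n) - lscale c (U n)) \<longlonglongrightarrow> 0"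
    using tendsto_mult_right_zero[OF tendsto_norm_zero[OF rep_qlim[OF assms]], of "cmod c"]
    by (subst tendsto_norm_zero_iff[symmetric]) (simp add: lscale_simps(9) flip: lscale_simps(2))
  have "qscale c (qlim U) = qlim (\<lambda>n. lscale c (rep (qlim U) n))"
    unfolding qscale_def qlim_def[of "\<lambda>n. lscale c (_ n)"] by (simp add: rep_seq_eq lscale.rep_eq)
  also have "\<dots> = qlim (\<lambda>n. lscale c (U n))"
    using lim by (subst qlim_eq_iff) (simp_all add: assms Cauchy_lscale Cauchy_rep)
  finally show ?thesis .
qed

lemma qstar_qlim:
  assumes "Cauchy U"
  shows "qstar (qlim U) = qlim (\<lambda>n. lstar (U n))"
proof -
  have lim: "(\<lambda>n. lstar (rep (qlim U) n) - lstar (U n)) \<longlonglongrightarrow> 0"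
    using tendsto_norm_zero[OF rep_qlim[OF assms]]
    by (subst tendsto_norm_zero_iff[symmetric]) (simp add: norm_lstar flip: lstar_simps(2))
  have "qstar (qlim U) = qlim (\<lambda>n. lstar (rep (qlim U) n))"
    unfolding qstar_def qlim_def[of "\<lambda>n. lstar (_ n)"] by (simp add: rep_seq_eq lstar.rep_eq)
  also have "\<dots> = qlim (\<lambda>n. lstar (U n))"
    using lim by (subst qlim_eq_iff) (simp_all add: assms Cauchy_lstar Cauchy_rep)
  finally show ?thesis .
qed

text \<open>\<open>lim\<close> is meaningful only for a convergent sequence. The reverse triangle
  inequality makes the norms a Cauchy sequence of reals, and also shows that equivalent
  representatives have the same limit.\<close>

lemma qnorm_qlim:
  assumes "Cauchy U"
  shows "(\<lambda>n. norm (U n)) \<longlonglongrightarrow> qnorm (qlim U)"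
proof -
  have "convergent (\<lambda>n. norm (rep (qlim U) n))"
  proof (rule Cauchy_convergent, rule CauchyI)
    fix e :: real assume "0 < e"
    then obtain N where "\<And>m n. N \<le> m \<Longrightarrow> N \<le> n \<Longrightarrow> norm (rep (qlim U) m - rep (qlim U) n) < e"
      using CauchyD[OF Cauchy_rep] by blast
    then show "\<exists>N. \<forall>m\<ge>N. \<forall>n\<ge>N. norm (norm (rep (qlim U) m) - norm (rep (qlim U) n)) < e"
      by (metis norm_triangle_ineq3 order_le_less_trans real_norm_def)
  qed
  then have "(\<lambda>n. norm (rep (qlim U) n)) \<longlonglongrightarrow> qnorm (qlim U)"
    by (simp add: convergent_LIMSEQ_iff qnorm_def rep_seq_eq norm_lker.rep_eq)
  moreover have "(\<lambda>n. norm (U n) - norm (rep (qlim U) n)) \<longlonglongrightarrow> 0"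
    by (rule tendsto_rabs_zero_cancel, rule tendsto_sandwich[OF _ _ tendsto_const
          tendsto_norm_zero[OF rep_qlim[OF assms]]])
       (auto simp: norm_minus_commute[of "rep _ _"] norm_triangle_ineq3)
  ultimately have "(\<lambda>n. norm (rep (qlim U) n) + (norm (U n) - norm (rep (qlim U) n))) \<longlonglongrightarrow> qnorm (qlim U) + 0"
    by (rule tendsto_add)
  then show ?thesis by simp
qed

instantiation qloc :: (finite) real_normed_algebra_1
begin

definition zero_qloc :: "'a qloc" where "zero_qloc = qzero"
definition one_qloc :: "'a qloc" where "one_qloc = qone"
definition plus_qloc :: "'a qloc \<Rightarrow> 'a qloc \<Rightarrow> 'a qloc" where "plus_qloc = qadd"
definition minus_qloc :: "'a qloc \<Rightarrow> 'a qloc \<Rightarrow> 'a qloc" where "minus_qloc = qdiff"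
definition uminus_qloc :: "'a qloc \<Rightarrow> 'a qloc" where "uminus_qloc = qscale (-1)"
definition times_qloc :: "'a qloc \<Rightarrow> 'a qloc \<Rightarrow> 'a qloc" where "times_qloc = qmult"
definition scaleR_qloc :: "real \<Rightarrow> 'a qloc \<Rightarrow> 'a qloc" where "scaleR_qloc r = qscale (of_real r)"
definition norm_qloc :: "'a qloc \<Rightarrow> real" where "norm_qloc = qnorm"

definition dist_qloc :: "'a qloc \<Rightarrow> 'a qloc \<Rightarrow> real" where
  "dist_qloc a b = norm (a - b)"

definition [code del]:
  "(uniformity :: ('a qloc \<times> 'a qloc) filter) = (INF e\<in>{0 <..}. principal {(x, y). dist x y < e})"

definition open_qloc :: "'a qloc set \<Rightarrow> bool" where
  [code del]: "open_qloc S = (\<forall>x\<in>S. \<forall>\<^sub>F (x', y) in uniformity. x' = x \<longrightarrow> y \<in> S)"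

definition sgn_qloc :: "'a qloc \<Rightarrow> 'a qloc" where
  "sgn_qloc a = inverse (norm a) *\<^sub>R a"

text \<open>These rules turn an algebraic class axiom into the same law for each term of the
  representing sequences; the norm axioms follow by passing to the limit.\<close>

lemma qlim_simps:
  fixes U V :: "nat \<Rightarrow> 'a lker"
  shows "0 = qlim (\<lambda>_. 0 :: 'a lker)" "1 = qlim (\<lambda>_. 1 :: 'a lker)"
    and "Cauchy U \<Longrightarrow> Cauchy V \<Longrightarrow> qlim U + qlim V = qlim (\<lambda>n. U n + V n)"
    and "Cauchy U \<Longrightarrow> Cauchy V \<Longrightarrow> qlim U - qlim V = qlim (\<lambda>n. U n - V n)"
    and "Cauchy U \<Longrightarrow> Cauchy V \<Longrightarrow> qlim U * qlim V = qlim (\<lambda>n. U n * V n)"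
    and "Cauchy U \<Longrightarrow> - qlim U = qlim (\<lambda>n. - U n)"
    and "Cauchy U \<Longrightarrow> r *\<^sub>R qlim U = qlim (\<lambda>n. r *\<^sub>R U n)"
    and "Cauchy U \<Longrightarrow> (\<lambda>n. norm (U n)) \<longlonglongrightarrow> norm (qlim U)"
  subgoal by (simp add: zero_qloc_def qzero_def qlim_def zero_lker.rep_eq)
  subgoal by (simp add: one_qloc_def qone_def qlim_def one_lker.rep_eq)
  subgoal by (simp add: plus_qloc_def qadd_qlim)
  subgoal by (simp add: minus_qloc_def qdiff_qlim)
  subgoal by (simp add: times_qloc_def qmult_qlim)
  subgoal by (simp add: uminus_qloc_def qscale_qlim lscale_minus_one)
  subgoal by (simp add: scaleR_qloc_def qscale_qlim lscale_simps)
  subgoal by (simp add: norm_qloc_def qnorm_qlim)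
  done

instance
proof
  fix a b c :: "'a qloc" and r s :: real
  obtain U where U: "Cauchy U" "a = qlim U" by (rule qloc_cases)
  obtain V where V: "Cauchy V" "b = qlim V" by (rule qloc_cases)
  obtain W where W: "Cauchy W" "c = qlim W" by (rule qloc_cases)
  note cauchy = U(1) V(1) W(1) Cauchy_const Cauchy_add Cauchy_mult
    bounded_linear.Cauchy[OF bounded_linear_minus[OF bounded_linear_ident]]
    bounded_linear.Cauchy[OF bounded_linear_scaleR_right]
  show "a + b + c = a + (b + c)" by (simp add: U(2) V(2) W(2) qlim_simps cauchy add.assoc)
  show "a + b = b + a" by (simp add: U(2) V(2) W(2) qlim_simps cauchy add.commute)
  show "0 + a = a" by (simp add: U(2) V(2) W(2) qlim_simps cauchy)
  show "- a + a = 0" by (simp add: U(2) V(2) W(2) qlim_simps cauchy)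
  show "a - b = a + - b" by (simp add: U(2) V(2) W(2) qlim_simps cauchy)
  show "r *\<^sub>R (a + b) = r *\<^sub>R a + r *\<^sub>R b" by (simp add: U(2) V(2) W(2) qlim_simps cauchy scaleR_add_right)
  show "(r + s) *\<^sub>R a = r *\<^sub>R a + s *\<^sub>R a" by (simp add: U(2) V(2) W(2) qlim_simps cauchy scaleR_add_left)
  show "r *\<^sub>R s *\<^sub>R a = (r * s) *\<^sub>R a" by (simp add: U(2) V(2) W(2) qlim_simps cauchy)
  show "1 *\<^sub>R a = a" by (simp add: U(2) V(2) W(2) qlim_simps cauchy)
  show "a * b * c = a * (b * c)" by (simp add: U(2) V(2) W(2) qlim_simps cauchy mult.assoc)
  show "(a + b) * c = a * c + b * c" by (simp add: U(2) V(2) W(2) qlim_simps cauchy distrib_right)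
  show "a * (b + c) = a * b + a * c" by (simp add: U(2) V(2) W(2) qlim_simps cauchy distrib_left)
  show "1 * a = a" by (simp add: U(2) V(2) W(2) qlim_simps cauchy)
  show "a * 1 = a" by (simp add: U(2) V(2) W(2) qlim_simps cauchy)
  show "r *\<^sub>R a * b = r *\<^sub>R (a * b)" by (simp add: U(2) V(2) W(2) qlim_simps cauchy)
  show "a * r *\<^sub>R b = r *\<^sub>R (a * b)" by (simp add: U(2) V(2) W(2) qlim_simps cauchy)
  show "(0 :: 'a qloc) \<noteq> 1"
    by (simp add: qlim_simps qlim_eq_iff Cauchy_const LIMSEQ_const_iff)
  show "sgn a = inverse (norm a) *\<^sub>R a" by (rule sgn_qloc_def)
  show "dist a b = norm (a - b)" by (rule dist_qloc_def)
  show "(uniformity :: ('a qloc \<times> 'a qloc) filter) = (INF e\<in>{0 <..}. principal {(x, y). dist x y < e})"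
    by (rule uniformity_qloc_def)
  show "open S = (\<forall>x\<in>S. \<forall>\<^sub>F (x', y) in uniformity. x' = x \<longrightarrow> y \<in> S)" for S :: "'a qloc set"
    by (rule open_qloc_def)
  note lim_a = qlim_simps(8)[OF U(1)] and lim_b = qlim_simps(8)[OF V(1)]
  show "norm a = 0 \<longleftrightarrow> a = 0"
  proof -
    have "a = 0 \<longleftrightarrow> (\<lambda>n. norm (U n)) \<longlonglongrightarrow> 0"
      using qlim_eq_iff[OF U(1) Cauchy_const, of 0] by (simp add: U(2) qlim_simps tendsto_norm_zero_iff)
    then show ?thesis using lim_a U(2) LIMSEQ_unique by metis
  qed
  show "norm (a + b) \<le> norm a + norm b"
    using qlim_simps(8)[OF Cauchy_add[OF U(1) V(1)]] tendsto_add[OF lim_a lim_b]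
    by (intro LIMSEQ_le) (auto simp: U V qlim_simps norm_triangle_ineq)
  show "norm (a * b) \<le> norm a * norm b"
    using qlim_simps(8)[OF Cauchy_mult[OF U(1) V(1)]] tendsto_mult[OF lim_a lim_b]
    by (intro LIMSEQ_le) (auto simp: U V qlim_simps norm_mult_ineq)
  show "norm (r *\<^sub>R a) = \<bar>r\<bar> * norm a"
    using qlim_simps(8)[OF cauchy(8)[OF U(1), of r]] tendsto_mult_left[OF lim_a, of "\<bar>r\<bar>"]
    by (intro LIMSEQ_unique) (auto simp: U qlim_simps)
  show "norm (1 :: 'a qloc) = 1"
    using qlim_simps(8)[OF Cauchy_const, of "1 :: 'a lker"] by (simp add: LIMSEQ_const_iff flip: qlim_simps)
qed

end

section \<open>Completeness of the quasi-local algebra\<close>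

lemma dist_qlim_const_le:
  assumes U: "Cauchy (U :: nat \<Rightarrow> 'h::finite lker)" and le: "\<And>n. N \<le> n \<Longrightarrow> norm (a - U n) \<le> e"
  shows "dist (qlim (\<lambda>_. a)) (qlim U) \<le> e"
proof -
  have "(\<lambda>n. norm (a - U n)) \<longlonglongrightarrow> norm (qlim (\<lambda>_. a) - qlim U)"
    using qlim_simps(8)[OF Cauchy_diff[OF Cauchy_const U], of a] U
    by (simp add: qlim_simps Cauchy_const)
  then have "norm (qlim (\<lambda>_. a) - qlim U) \<le> e"
    by (rule LIMSEQ_le_const2) (use le in blast)
  then show ?thesis by (simp add: dist_norm)
qed

lemma dist_qlim_const: "dist (qlim (\<lambda>_. a)) (qlim (\<lambda>_. b)) = dist a (b :: 'h::finite lker)"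
proof -
  have "norm (a - b) = norm (qlim (\<lambda>_. a - b))"
    using qlim_simps(8)[OF Cauchy_const, of "a - b"] by (simp only: LIMSEQ_const_iff)
  then show ?thesis by (simp add: dist_norm qlim_simps(4) Cauchy_const)
qed

lemma qlim_const_dense:
  fixes x :: "'h::finite qloc"
  assumes "0 < e"
  obtains a where "dist (qlim (\<lambda>_. a)) x < e"
proof -
  obtain U where U: "Cauchy U" "x = qlim U" by (rule qloc_cases)
  obtain N where N: "\<And>m n. N \<le> m \<Longrightarrow> N \<le> n \<Longrightarrow> norm (U m - U n) < e / 2"
    using CauchyD[OF U(1) half_gt_zero[OF assms]] by blast
  have "dist (qlim (\<lambda>_. U N)) x \<le> e / 2"
    unfolding U(2) by (rule dist_qlim_const_le[OF U(1), of N]) (use N[OF order_refl] in \<open>blast intro: less_imp_le\<close>)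
  then show ?thesis using that[of "U N"] assms by linarith
qed

text \<open>Approximate \<open>X n\<close> within 1/(n+1) by a local observable \<open>U n\<close>.
  Constant sequences embed isometrically, so \<open>U\<close> is itself Cauchy among the local
  observables, and its class is the limit of \<open>X\<close>.\<close>

instance qloc :: (finite) banach
proof
  fix X :: "nat \<Rightarrow> 'a qloc" assume X: "Cauchy X"
  have "\<exists>a. dist (qlim (\<lambda>_. a)) (X n) < inverse (real (Suc n))" for n
  proof -
    obtain a where "dist (qlim (\<lambda>_. a)) (X n) < inverse (real (Suc n))"
      by (rule qlim_const_dense[of "inverse (real (Suc n))" "X n"]) (simp, blast)
    then show ?thesis by blast
  qed
  then obtain U where U: "\<And>n. dist (qlim (\<lambda>_. U n)) (X n) < inverse (real (Suc n))" by metis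
  have close: "(\<lambda>n. dist (qlim (\<lambda>_. U n)) (X n)) \<longlonglongrightarrow> 0"
    by (rule tendsto_sandwich[OF _ _ tendsto_const LIMSEQ_inverse_real_of_nat])
       (use U in \<open>simp_all add: less_imp_le\<close>)
  have U': "Cauchy U"
  proof (rule metric_CauchyI)
    fix e :: real assume e: "0 < e"
    have e3: "0 < e / 3" using e by simp
    obtain N1 where N1: "\<And>m n. N1 \<le> m \<Longrightarrow> N1 \<le> n \<Longrightarrow> dist (X m) (X n) < e / 3"
      using metric_CauchyD[OF X e3] by blast
    obtain N2 where N2: "\<And>n. N2 \<le> n \<Longrightarrow> dist (qlim (\<lambda>_. U n)) (X n) < e / 3"
      using order_tendstoD(2)[OF close e3] unfolding eventually_sequentially by blast
    show "\<exists>N. \<forall>m\<ge>N. \<forall>n\<ge>N. dist (U m) (U n) < e"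
    proof (intro exI allI impI)
      fix m n assume "max N1 N2 \<le> m" "max N1 N2 \<le> n"
      then have "dist (X m) (X n) < e / 3" "dist (qlim (\<lambda>_. U m)) (X m) < e / 3"
        "dist (qlim (\<lambda>_. U n)) (X n) < e / 3" using N1 N2 by auto
      then have "dist (qlim (\<lambda>_. U m)) (qlim (\<lambda>_. U n)) < e"
        using dist_triangle[of "qlim (\<lambda>_. U m)" "qlim (\<lambda>_. U n)" "X m"]
          dist_triangle[of "X m" "qlim (\<lambda>_. U n)" "X n"] dist_commute[of "X n" "qlim (\<lambda>_. U n)"]
        by linarith
      then show "dist (U m) (U n) < e" by (simp add: dist_qlim_const)
    qed
  qed
  have "(\<lambda>n. dist (qlim (\<lambda>_. U n)) (qlim U)) \<longlonglongrightarrow> 0"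
  proof (rule LIMSEQ_I)
    fix e :: real assume e: "0 < e"
    obtain N where N: "\<And>m n. N \<le> m \<Longrightarrow> N \<le> n \<Longrightarrow> norm (U m - U n) < e / 2"
      using CauchyD[OF U' half_gt_zero[OF e]] by blast
    have "dist (qlim (\<lambda>_. U n)) (qlim U) \<le> e / 2" if "N \<le> n" for n
      by (rule dist_qlim_const_le[OF U', of N]) (use N that in \<open>blast intro: less_imp_le\<close>)
    moreover have "e / 2 < e" using e by simp
    ultimately have "norm (dist (qlim (\<lambda>_. U n)) (qlim U) - 0) < e" if "N \<le> n" for n
      using that by (metis abs_of_nonneg diff_zero order_le_less_trans real_norm_def zero_le_dist)
    then show "\<exists>N. \<forall>n\<ge>N. norm (dist (qlim (\<lambda>_. U n)) (qlim U) - 0) < e" by blast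
  qed
  from tendsto_add[OF close this]
  have sum: "(\<lambda>n. dist (qlim (\<lambda>_. U n)) (X n) + dist (qlim (\<lambda>_. U n)) (qlim U)) \<longlonglongrightarrow> 0" by simp
  have "(\<lambda>n. dist (X n) (qlim U)) \<longlonglongrightarrow> 0"
    by (rule tendsto_sandwich[OF _ _ tendsto_const sum])
       (simp_all add: dist_triangle3)
  then have "X \<longlonglongrightarrow> qlim U" by (simp only: tendsto_dist_iff[symmetric])
  then show "convergent X" by (rule convergentI)
qed

section \<open>Complex scalars and the star on the completion\<close>

lemma qscale_simps:
  fixes a b :: "'h::finite qloc"
  shows "qscale c (a + b) = qscale c a + qscale c b"
    and "qscale (c + d) a = qscale c a + qscale d a"
    and "qscale c (qscale d a) = qscale (c * d) a"
    and "qscale 1 a = a"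
    and "qscale c a * b = qscale c (a * b)" "a * qscale c b = qscale c (a * b)"
    and "norm (qscale c a) = cmod c * norm a"
proof -
  obtain U where U: "Cauchy U" "a = qlim U" by (rule qloc_cases)
  obtain V where V: "Cauchy V" "b = qlim V" by (rule qloc_cases)
  note cauchy = U(1) V(1) Cauchy_add Cauchy_mult Cauchy_lscale
  show "qscale c (a + b) = qscale c a + qscale c b" "qscale (c + d) a = qscale c a + qscale d a"
    "qscale c (qscale d a) = qscale (c * d) a" "qscale 1 a = a"
    "qscale c a * b = qscale c (a * b)" "a * qscale c b = qscale c (a * b)"
    by (simp_all add: U(2) V(2) cauchy qlim_simps qscale_qlim lscale_simps)
  show "norm (qscale c a) = cmod c * norm a"
    using qlim_simps(8)[OF Cauchy_lscale[OF U(1), of c]] tendsto_mult_left[OF qlim_simps(8)[OF U(1)], of "cmod c"]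
    by (intro LIMSEQ_unique) (auto simp: U qscale_qlim lscale_simps)
qed

lemma qstar_simps:
  fixes a b :: "'h::finite qloc"
  shows "qstar (a + b) = qstar a + qstar b" "qstar (a * b) = qstar b * qstar a"
    and "qstar (qscale c a) = qscale (cnj c) (qstar a)"
    and "qstar 1 = (1 :: 'h qloc)" "qstar (qstar a) = a" "norm (qstar a) = norm a"
proof -
  obtain U where U: "Cauchy U" "a = qlim U" by (rule qloc_cases)
  obtain V where V: "Cauchy V" "b = qlim V" by (rule qloc_cases)
  note cauchy = U(1) V(1) Cauchy_add Cauchy_mult Cauchy_lscale Cauchy_lstar Cauchy_const
  show "qstar (a + b) = qstar a + qstar b" "qstar (a * b) = qstar b * qstar a"
    "qstar (qscale c a) = qscale (cnj c) (qstar a)" "qstar 1 = (1 :: 'h qloc)" "qstar (qstar a) = a"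
    by (simp_all add: U(2) V(2) cauchy qlim_simps qscale_qlim qstar_qlim lstar_simps lstar_mult)
  show "norm (qstar a) = norm a"
    using qlim_simps(8)[OF Cauchy_lstar[OF U(1)]] qlim_simps(8)[OF U(1)]
    by (intro LIMSEQ_unique) (auto simp: U qstar_qlim norm_lstar)
qed

lemma scaleR_qscale: "r *\<^sub>R (a :: 'h::finite qloc) = qscale (of_real r) a"
  by (simp add: scaleR_qloc_def)

text \<open>The star is conjugate linear over the complex numbers but linear over the reals, which
  lets it pass through infinite sums and uniform limits.\<close>

lemma bounded_linear_qstar: "bounded_linear (qstar :: 'h::finite qloc \<Rightarrow> 'h qloc)"
  by (rule bounded_linear_intro[of _ 1]) (simp_all add: qstar_simps scaleR_qscale)

lemmas qloc_ops = plus_qloc_def[symmetric] minus_qloc_def[symmetric] times_qloc_def[symmetric]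
  zero_qloc_def[symmetric] one_qloc_def[symmetric] norm_qloc_def[symmetric]

lemma qsumN_eq_sum: "qsumN n b = (\<Sum>i<n. b i :: 'h::finite qloc)"
  by (induction n) (simp_all add: qloc_ops)

section \<open>Square roots\<close>

text \<open>The Taylor coefficients at 0 of the square root of 1 - t.\<close>

definition sqrt_coeff :: "nat \<Rightarrow> real" where
  "sqrt_coeff n = ((1 / 2) gchoose n) * (-1) ^ n"

definition sqrt_series :: "'x::{real_normed_algebra_1, banach} \<Rightarrow> 'x" where
  "sqrt_series b = (\<Sum>n. sqrt_coeff n *\<^sub>R b ^ n)"

text \<open>The real binomial series converges at every point of modulus below 1. Taking
  \<open>s\<close> halfway between r and 1 makes the convergence at r absolute, which gives one
  summable majorant for all b of norm at most r.\<close>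

lemma summable_sqrt_coeff:
  assumes "0 \<le> r" "r < 1"
  shows "summable (\<lambda>n. \<bar>sqrt_coeff n\<bar> * r ^ n)"
proof -
  define s where "s = (r + 1) / 2"
  have s: "r < s" "0 < s" "s < 1" using assms by (auto simp: s_def)
  have "summable (\<lambda>n. ((1 / 2) gchoose n) * s ^ n :: real)"
    using gen_binomial_real[of s "1 / 2"] s by (simp add: sums_iff)
  from powser_insidea[OF this, of r] s assms
  show ?thesis by (simp add: sqrt_coeff_def abs_mult power_abs)
qed

lemma norm_sqrt_term_le:
  fixes b :: "'x::real_normed_algebra_1"
  assumes "norm b \<le> r"
  shows "norm (sqrt_coeff n *\<^sub>R b ^ n) \<le> \<bar>sqrt_coeff n\<bar> * r ^ n"
  using order_trans[OF norm_power_ineq power_mono[OF assms norm_ge_zero]]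
  by (simp add: mult_left_mono)

lemma summable_norm_sqrt_series:
  fixes b :: "'x::{real_normed_algebra_1, banach}"
  assumes "norm b < 1"
  shows "summable (\<lambda>n. norm (sqrt_coeff n *\<^sub>R b ^ n))"
  by (rule summable_comparison_test'[OF summable_sqrt_coeff[OF norm_ge_zero assms], of 0])
     (use norm_sqrt_term_le[OF order_refl] in simp)

text \<open>Vandermonde's identity makes the Cauchy square of the binomial series of exponent \<open>1 / 2\<close>
  collapse to the one of exponent \<open>1\<close>.\<close>
lemma sqrt_series_square:
  fixes b :: "'x::{real_normed_algebra_1, banach}"
  assumes "norm b < 1"
  shows "sqrt_series b * sqrt_series b = 1 - b"
proof -
  have conv: "(\<Sum>i\<le>k. (sqrt_coeff i *\<^sub>R b ^ i) * (sqrt_coeff (k - i) *\<^sub>R b ^ (k - i)))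
      = (real (1 choose k) * (-1) ^ k) *\<^sub>R b ^ k" for k
  proof -
    have "(sqrt_coeff i *\<^sub>R b ^ i) * (sqrt_coeff (k - i) *\<^sub>R b ^ (k - i))
        = (((1 / 2) gchoose i) * ((1 / 2) gchoose (k - i)) * (-1) ^ k) *\<^sub>R b ^ k" if "i \<le> k" for i
    proof -
      have "b ^ i * b ^ (k - i) = b ^ k" "(-1 :: real) ^ i * (-1) ^ (k - i) = (-1) ^ k"
        using that by (simp_all flip: power_add)
      then show ?thesis by (simp add: sqrt_coeff_def mult_ac)
    qed
    then have "(\<Sum>i\<le>k. (sqrt_coeff i *\<^sub>R b ^ i) * (sqrt_coeff (k - i) *\<^sub>R b ^ (k - i)))
        = ((\<Sum>i\<le>k. ((1 / 2) gchoose i) * ((1 / 2) gchoose (k - i))) * (-1) ^ k) *\<^sub>R b ^ k"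
      by (simp add: scaleR_left.sum sum_distrib_right)
    also have "(\<Sum>i\<le>k. ((1 / 2) gchoose i) * ((1 / 2 :: real) gchoose (k - i))) = real (1 choose k)"
      using gbinomial_Vandermonde[of "1 / 2 :: real" "1 / 2" k]
      by (simp add: binomial_gbinomial atMost_atLeast0)
    finally show ?thesis .
  qed
  have "(\<lambda>k. (real (1 choose k) * (-1) ^ k) *\<^sub>R b ^ k) sums (sqrt_series b * sqrt_series b)"
    using Cauchy_product_sums[OF summable_norm_sqrt_series[OF assms] summable_norm_sqrt_series[OF assms]]
    by (simp only: conv sqrt_series_def)
  moreover have "(\<lambda>k. (real (1 choose k) * (-1) ^ k) *\<^sub>R b ^ k)
      sums (\<Sum>k\<in>{0, 1}. (real (1 choose k) * (-1) ^ k) *\<^sub>R b ^ k)"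
  proof (rule sums_finite)
    fix k assume "k \<notin> {0, 1 :: nat}"
    then have "(1 :: nat) choose k = 0" by (intro binomial_eq_0) auto
    then show "(real (1 choose k) * (-1) ^ k) *\<^sub>R b ^ k = 0" by simp
  qed simp
  ultimately have "sqrt_series b * sqrt_series b = (\<Sum>k\<in>{0, 1}. (real (1 choose k) * (-1) ^ k) *\<^sub>R b ^ k)"
    by (rule sums_unique2)
  then show ?thesis by simp
qed

lemma qstar_power: "qstar (a ^ n) = qstar a ^ n" for a :: "'h::finite qloc"
  by (induction n) (simp_all add: qstar_simps power_commutes)

text \<open>The coefficients are real and the star is continuous. Self-adjointness gives the square
  of the root the form \<open>qstar y * y\<close> demanded by \<open>qpos\<close> and
  \<open>tens_pos\<close>.\<close>

lemma qstar_sqrt_series: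
  fixes b :: "'h::finite qloc"
  assumes "norm b < 1" "qstar b = b"
  shows "qstar (sqrt_series b) = sqrt_series b"
proof -
  have "qstar (sqrt_series b) = (\<Sum>n. qstar (sqrt_coeff n *\<^sub>R b ^ n))"
    unfolding sqrt_series_def
    by (rule bounded_linear.suminf[OF bounded_linear_qstar])
       (rule summable_norm_cancel[OF summable_norm_sqrt_series[OF assms(1)]])
  also have "\<dots> = sqrt_series b"
    using assms(2) by (simp add: sqrt_series_def scaleR_qscale qstar_simps qstar_power)
  finally show ?thesis .
qed

text \<open>The majorant depends on r alone, so the Weierstrass test applies. A single r for all
  points is what later keeps the square root inside a uniform closure.\<close>

lemma uniform_limit_sqrt_series:
  fixes g :: "'y \<Rightarrow> 'x::{real_normed_algebra_1, banach}"
  assumes "r < 1" "\<And>x. norm (g x) \<le> r"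
  shows "uniform_limit UNIV (\<lambda>n x. \<Sum>i<n. sqrt_coeff i *\<^sub>R g x ^ i) (\<lambda>x. sqrt_series (g x)) sequentially"
proof -
  have "0 \<le> r" using assms(2) norm_ge_zero order_trans by blast
  then show ?thesis
    unfolding sqrt_series_def
    by (intro Weierstrass_m_test[where M = "\<lambda>n. \<bar>sqrt_coeff n\<bar> * r ^ n"])
       (simp_all add: norm_sqrt_term_le assms summable_sqrt_coeff del: norm_scaleR)
qed

section \<open>The tensor product with the bounded Borel functions\<close>

lemma Bfun_const: "(\<lambda>_. c) \<in> Bfun"
  by (simp add: Bfun_def image_constant_conv)

lemma Bfun_iff: "f \<in> Bfun \<longleftrightarrow> f \<in> borel_measurable SigmaC \<and> (\<exists>B. \<forall>x. cmod (f x) \<le> B)"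
  by (simp add: Bfun_def bounded_iff)

lemma Bfun_mult:
  assumes "f \<in> Bfun" "g \<in> Bfun"
  shows "(\<lambda>x. f x * g x) \<in> Bfun"
proof -
  obtain B C where "\<forall>x. cmod (f x) \<le> B" "\<forall>x. cmod (g x) \<le> C" using assms by (auto simp: Bfun_iff)
  then have "cmod (f x * g x) \<le> B * C" for x
    unfolding norm_mult by (meson mult_mono norm_ge_zero order_trans)
  moreover have "(\<lambda>x. f x * g x) \<in> borel_measurable SigmaC"
    using assms by (intro borel_measurable_times) (simp_all add: Bfun_iff)
  ultimately show ?thesis unfolding Bfun_iff by blast
qed

lemma Bfun_cnj:
  assumes "f \<in> Bfun"
  shows "(\<lambda>x. cnj (f x)) \<in> Bfun"
proof -
  have "cnj \<in> borel_measurable borel" by (intro borel_measurable_continuous_onI continuous_intros)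
  then show ?thesis using assms measurable_compose[of f SigmaC borel cnj] by (simp add: Bfun_iff)
qed

text \<open>The algebraic tensor product, generated one elementary tensor at a time. Induction
  replaces the bookkeeping with indexed families that the definition of \<open>tens\<close> would
  require; \<open>simple_iff\<close> connects the two forms.\<close>

inductive_set simple :: "('a config \<Rightarrow> 'h::finite qloc) set" where
  simple_zero: "(\<lambda>_. 0) \<in> simple"
| simple_step: "s \<in> simple \<Longrightarrow> f \<in> Bfun \<Longrightarrow> (\<lambda>x. s x + qscale (f x) b) \<in> simple"

lemma simple_iff:
  "s \<in> simple \<longleftrightarrow>
    (\<exists>(N::nat) fs bs. (\<forall>i<N. fs i \<in> Bfun) \<and> s = (\<lambda>x. \<Sum>i<N. qscale (fs i x) (bs i)))"
proof
  assume "s \<in> simple"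
  then show "\<exists>(N::nat) fs bs. (\<forall>i<N. fs i \<in> Bfun) \<and> s = (\<lambda>x. \<Sum>i<N. qscale (fs i x) (bs i))"
  proof induction
    case simple_zero
    show ?case by (rule exI[of _ "0 :: nat"]) simp
  next
    case (simple_step s f b)
    from simple_step.IH obtain N :: nat and fs bs
      where N: "\<forall>i<N. fs i \<in> Bfun" "s = (\<lambda>x. \<Sum>i<N. qscale (fs i x) (bs i))"
      by (elim exE conjE) (rule that)
    show ?case
      by (rule exI[of _ "Suc N"], rule exI[of _ "fs(N := f)"], rule exI[of _ "bs(N := b)"])
         (use N simple_step(2) in \<open>auto simp: less_Suc_eq intro!: sum.cong\<close>)
  qed
next
  assume "\<exists>(N::nat) fs bs. (\<forall>i<N. fs i \<in> Bfun) \<and> s = (\<lambda>x. \<Sum>i<N. qscale (fs i x) (bs i))"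
  then obtain N :: nat and fs bs
    where "\<forall>i<N. fs i \<in> Bfun" "s = (\<lambda>x. \<Sum>i<N. qscale (fs i x) (bs i))"
    by (elim exE conjE) (rule that)
  then show "s \<in> simple"
    by (induction N arbitrary: s) (simp_all add: simple_zero simple_step)
qed

lemma qscale_zero: "qscale 0 a = (0 :: 'h::finite qloc)"
  using scaleR_qscale[of 0 a] by simp

lemma simple_elementary: "f \<in> Bfun \<Longrightarrow> (\<lambda>x. qscale (f x) b) \<in> simple"
  using simple_step[OF simple_zero] by simp

lemma simple_add: "t \<in> simple \<Longrightarrow> s \<in> simple \<Longrightarrow> (\<lambda>x. s x + t x) \<in> simple"
proof (induction t rule: simple.induct)
  case (simple_step t f b)
  then show ?case using simple.simple_step[of "\<lambda>x. s x + t x" f b] by (simp add: add.assoc)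
qed simp

lemma simple_star: "s \<in> simple \<Longrightarrow> (\<lambda>x. qstar (s x)) \<in> simple"
proof (induction s rule: simple.induct)
  case simple_zero
  have "qstar 0 = (0 :: 'b qloc)" using linear_0 bounded_linear_qstar bounded_linear.linear by blast
  then show ?case by (simp add: simple.simple_zero)
next
  case (simple_step s f b)
  then show ?case
    using simple.simple_step[OF simple_step.IH Bfun_cnj[OF simple_step(2)], of "qstar b"]
    by (simp add: qstar_simps)
qed

text \<open>Together with \<open>simple_mult\<close> this is a double induction: here over the left
  factor, there over the right one.\<close>

lemma simple_mult_elementary: "s \<in> simple \<Longrightarrow> f \<in> Bfun \<Longrightarrow> (\<lambda>x. s x * qscale (f x) b) \<in> simple"
proof (induction s rule: simple.induct)
  case (simple_step s g c)
  then show ?case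
    using simple.simple_step[OF simple_step.IH[OF simple_step(4)] Bfun_mult[OF simple_step(4,2)], of "c * b"]
    by (simp add: distrib_right qscale_simps)
qed (simp add: simple_zero)

lemma simple_mult: "t \<in> simple \<Longrightarrow> s \<in> simple \<Longrightarrow> (\<lambda>x. s x * t x) \<in> simple"
proof (induction t rule: simple.induct)
  case (simple_step t f b)
  then show ?case
    using simple_add[OF simple_mult_elementary[of s f b] simple_step.IH] by (simp add: distrib_left)
qed (simp add: simple_zero)

lemma simple_bounded: "s \<in> simple \<Longrightarrow> \<exists>B. \<forall>x. norm (s x) \<le> B"
proof (induction s rule: simple.induct)
  case (simple_step s f b)
  then obtain B C where B: "\<forall>x. norm (s x) \<le> B" and C: "\<forall>x. cmod (f x) \<le> C" by (auto simp: Bfun_iff)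
  have "norm (s x + qscale (f x) b) \<le> B + C * norm b" for x
    using B C by (intro order_trans[OF norm_triangle_ineq] add_mono) (auto simp: qscale_simps mult_right_mono)
  then show ?case by blast
qed auto

lemma tens_iff: "g \<in> tens \<longleftrightarrow> (\<forall>e>0. \<exists>s\<in>simple. \<forall>x. norm (g x - s x) \<le> e)"
  for g :: "'a config \<Rightarrow> 'h::finite qloc"
proof -
  have "(\<exists>s\<in>simple. \<forall>x. norm (g x - s x) \<le> e) \<longleftrightarrow>
      (\<exists>N fs bs. (\<forall>i<N. fs i \<in> Bfun) \<and>
        (\<forall>x. qnorm (qdiff (g x) (qsumN N (\<lambda>i. qscale (fs i x) (bs i)))) \<le> e))" (is "?L = ?R") for e
  proof
    assume ?L
    then obtain s where s: "s \<in> simple" "\<forall>x. norm (g x - s x) \<le> e" by (elim bexE) (rule that)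
    from s(1)[unfolded simple_iff] obtain N :: nat and fs bs
      where N: "\<forall>i<N. fs i \<in> Bfun" "s = (\<lambda>x. \<Sum>i<N. qscale (fs i x) (bs i))"
      by (elim exE conjE) (rule that)
    from s(2) N(1) show ?R
      unfolding N(2) qsumN_eq_sum qloc_ops by (intro exI conjI)
  next
    assume ?R
    then obtain N :: nat and fs bs where N: "\<forall>i<N. fs i \<in> Bfun"
        "\<forall>x. norm (g x - (\<Sum>i<N. qscale (fs i x) (bs i))) \<le> e"
      unfolding qsumN_eq_sum qloc_ops by (elim exE conjE) (rule that)
    have "(\<lambda>x. \<Sum>i<N. qscale (fs i x) (bs i)) \<in> simple"
      unfolding simple_iff using N(1) by (intro exI[of _ N] exI[of _ fs] exI[of _ bs] conjI refl)
    with N(2) show ?L by (intro bexI)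
  qed
  then show ?thesis unfolding tens_def by simp
qed

lemma tens_approx:
  fixes g :: "'a config \<Rightarrow> 'h::finite qloc"
  assumes "g \<in> tens"
  obtains S where "\<And>n. S n \<in> simple" "uniform_limit UNIV S g sequentially"
proof -
  have "\<exists>s\<in>simple. \<forall>x. norm (g x - s x) \<le> inverse (real (Suc n))" for n
    using assms by (simp add: tens_iff)
  then obtain S where S: "\<And>n. S n \<in> simple" "\<And>n x. norm (g x - S n x) \<le> inverse (real (Suc n))" by metis
  have "uniform_limit UNIV S g sequentially"
  proof (rule uniform_limitI)
    fix e :: real assume "0 < e"
    from order_tendstoD(2)[OF LIMSEQ_inverse_real_of_nat this]
    show "\<forall>\<^sub>F n in sequentially. \<forall>x\<in>UNIV. dist (S n x) (g x) < e"
      by eventually_elim (use S(2) in \<open>auto simp: dist_norm norm_minus_commute intro: order_le_less_trans\<close>)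
  qed
  with S(1) show ?thesis by (rule that)
qed

lemma simple_imp_tens: "s \<in> simple \<Longrightarrow> s \<in> tens" for s :: "'a config \<Rightarrow> 'h::finite qloc"
  unfolding tens_iff by (auto intro!: bexI[of _ s])

text \<open>A uniform closure is uniformly closed. Closure of \<open>tens\<close> under sums,
  products, stars and square roots is obtained by approximating with simple functions or polynomials
  and applying this.\<close>

lemma tens_uniform_limit:
  fixes g :: "'a config \<Rightarrow> 'h::finite qloc"
  assumes "\<And>n. S n \<in> tens" "uniform_limit UNIV S g sequentially"
  shows "g \<in> tens"
  unfolding tens_iff
proof (intro allI impI)
  fix e :: real assume e: "0 < e"
  from uniform_limitD[OF assms(2) half_gt_zero[OF e]] obtain n where n: "\<And>x. dist (S n x) (g x) < e / 2"
    by (auto simp: eventually_sequentially)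
  obtain s where s: "s \<in> simple" "\<And>x. norm (S n x - s x) \<le> e / 2"
    using assms(1)[of n] half_gt_zero[OF e] by (metis tens_iff)
  have "norm (g x - s x) \<le> e" for x
    using norm_triangle_ineq[of "g x - S n x" "S n x - s x"] n[of x] s(2)[of x]
    by (simp add: dist_norm norm_minus_commute)
  with s(1) show "\<exists>s\<in>simple. \<forall>x. norm (g x - s x) \<le> e" by blast
qed

lemma tens_elementary: "f \<in> Bfun \<Longrightarrow> (\<lambda>x. qscale (f x) b) \<in> tens" for b :: "'h::finite qloc"
  by (intro simple_imp_tens simple_elementary)

lemma tens_const: "(\<lambda>_. b) \<in> tens" for b :: "'h::finite qloc"
  using tens_elementary[OF Bfun_const[of 1], of b] by (simp add: qscale_simps)

text \<open>Products of uniformly convergent sequences need bounded limits to converge uniformly in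
  general, so this prepares the closure under products.\<close>

lemma tens_bounded:
  fixes g :: "'a config \<Rightarrow> 'h::finite qloc"
  assumes "g \<in> tens"
  shows "\<exists>B. \<forall>x. norm (g x) \<le> B"
proof -
  obtain s where s: "s \<in> simple" "\<And>x. norm (g x - s x) \<le> 1" using assms by (metis tens_iff zero_less_one)
  obtain B where "\<And>x. norm (s x) \<le> B" using simple_bounded[OF s(1)] by blast
  then have "norm (g x) \<le> B + 1" for x
    using norm_triangle_ineq2[of "g x" "s x"] s(2)[of x] by (smt (verit))
  then show ?thesis by blast
qed

lemma tens_add:
  fixes g h :: "'a config \<Rightarrow> 'h::finite qloc"
  assumes "g \<in> tens" "h \<in> tens"
  shows "(\<lambda>x. g x + h x) \<in> tens"
proof -
  obtain S where S: "\<And>n. S n \<in> simple" "uniform_limit UNIV S g sequentially" using assms(1) tens_approx by blast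
  obtain T where T: "\<And>n. T n \<in> simple" "uniform_limit UNIV T h sequentially" using assms(2) tens_approx by blast
  show ?thesis
    by (rule tens_uniform_limit[OF _ uniform_limit_add[OF S(2) T(2)]])
       (intro simple_imp_tens simple_add S(1) T(1))
qed

lemma tens_mult:
  fixes g h :: "'a config \<Rightarrow> 'h::finite qloc"
  assumes "g \<in> tens" "h \<in> tens"
  shows "(\<lambda>x. g x * h x) \<in> tens"
proof -
  obtain S where S: "\<And>n. S n \<in> simple" "uniform_limit UNIV S g sequentially" using assms(1) tens_approx by blast
  obtain T where T: "\<And>n. T n \<in> simple" "uniform_limit UNIV T h sequentially" using assms(2) tens_approx by blast
  have "bounded (range g)" "bounded (range h)"
    using tens_bounded[OF assms(1)] tens_bounded[OF assms(2)] by (simp_all add: bounded_iff)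
  from uniform_lim_mult[OF S(2) T(2) this] show ?thesis
    by (rule tens_uniform_limit[rotated]) (intro simple_imp_tens simple_mult S(1) T(1))
qed

lemma tens_scale: "g \<in> tens \<Longrightarrow> (\<lambda>x. qscale c (g x)) \<in> tens" for g :: "'a config \<Rightarrow> 'h::finite qloc"
  using tens_mult[OF tens_const[of "qscale c 1"], of g] by (simp add: qscale_simps)

lemma tens_star:
  fixes g :: "'a config \<Rightarrow> 'h::finite qloc"
  assumes "g \<in> tens"
  shows "(\<lambda>x. qstar (g x)) \<in> tens"
proof -
  obtain S where S: "\<And>n. S n \<in> simple" "uniform_limit UNIV S g sequentially" using assms tens_approx by blast
  show ?thesis
    by (rule tens_uniform_limit[OF _ bounded_linear.uniform_limit[OF bounded_linear_qstar S(2)]])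
       (intro simple_imp_tens simple_star S(1))
qed

lemma tens_sqrt_series:
  fixes g :: "'a config \<Rightarrow> 'h::finite qloc"
  assumes "g \<in> tens" "r < 1" "\<And>x. norm (g x) \<le> r"
  shows "(\<lambda>x. sqrt_series (g x)) \<in> tens"
proof (rule tens_uniform_limit[OF _ uniform_limit_sqrt_series[OF assms(2,3)]])
  have pow: "(\<lambda>x. g x ^ n) \<in> tens" for n
    by (induction n) (simp_all add: tens_const tens_mult assms(1))
  show "(\<lambda>x. \<Sum>i<n. sqrt_coeff i *\<^sub>R g x ^ i) \<in> tens" for n
    by (induction n) (simp_all add: tens_const tens_add tens_scale pow scaleR_qscale)
qed

text \<open>\<open>tens_pos\<close> asks for a root that itself lies in \<open>tens\<close>; roots
  chosen point by point would not suffice. The partial sums of the binomial series are polynomials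
  in g, so their uniform limit is such a root.\<close>

lemma tens_pos_one_minus:
  fixes g :: "'a config \<Rightarrow> 'h::finite qloc"
  assumes "g \<in> tens" "r < 1" "\<And>x. norm (g x) \<le> r" "\<And>x. qstar (g x) = g x"
  shows "tens_pos (\<lambda>x. 1 - g x)"
proof -
  have "norm (g x) < 1" for x using assms(2,3) order_le_less_trans by blast
  then show ?thesis
    unfolding tens_pos_def
    by (intro bexI[OF _ tens_sqrt_series[OF assms(1-3)]])
       (simp add: qloc_ops qstar_sqrt_series sqrt_series_square assms(4))
qed

section \<open>Automatic continuity of positive functionals\<close>

lemma qscale_minus_one: "qscale (-1) a = - (a :: 'h::finite qloc)"
  by (simp add: uminus_qloc_def)

lemma cmod_le_1_if_cnonneg:
  assumes "cnonneg (1 - z)" "cnonneg (1 + z)"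
  shows "cmod z \<le> 1"
proof -
  have "z = complex_of_real (Re z)" using assms by (simp add: cnonneg_def complex_eq_iff)
  then have "cmod z = \<bar>Re z\<bar>" by (metis norm_of_real)
  then show ?thesis using assms by (simp add: cnonneg_def abs_le_iff)
qed

text \<open>For self-adjoint h of norm at most 1/2 both 1 + h and 1 - h are positive, so \<phi>(h)
  lies in [-1, 1]. A general g of norm at most r > 0 is 2r times a + i b with a and b of this kind,
  whence the bound 2r (1 + 1).\<close>

lemma positive_functional_bound:
  fixes \<phi> :: "('a config \<Rightarrow> 'h::finite qloc) \<Rightarrow> complex"
  assumes add: "\<And>g h. g \<in> tens \<Longrightarrow> h \<in> tens \<Longrightarrow> \<phi> (\<lambda>x. g x + h x) = \<phi> g + \<phi> h"
    and scale: "\<And>c g. g \<in> tens \<Longrightarrow> \<phi> (\<lambda>x. qscale c (g x)) = c * \<phi> g"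
    and pos: "\<And>g. g \<in> tens \<Longrightarrow> tens_pos g \<Longrightarrow> cnonneg (\<phi> g)"
    and one: "\<phi> (\<lambda>_. 1) = 1"
    and g: "g \<in> tens" "\<And>x. norm (g x) \<le> r"
  shows "cmod (\<phi> g) \<le> 4 * r"
proof -
  have selfadjoint: "cmod (\<phi> h) \<le> 1"
    if h: "h \<in> tens" "\<And>x. norm (h x) \<le> 1 / 2" "\<And>x. qstar (h x) = h x" for h
  proof (rule cmod_le_1_if_cnonneg)
    have shift: "cnonneg (1 + \<phi> k)"
      if k: "k \<in> tens" "\<And>x. norm (k x) \<le> 1 / 2" "\<And>x. qstar (k x) = k x" for k
    proof -
      have "tens_pos (\<lambda>x. 1 - qscale (-1) (k x))"
        using k by (intro tens_pos_one_minus[of _ "1 / 2"] tens_scale) (simp_all add: qscale_simps qstar_simps)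
      then have "tens_pos (\<lambda>x. 1 + k x)" by (simp add: qscale_minus_one)
      then have "cnonneg (\<phi> (\<lambda>x. 1 + k x))" by (rule pos[OF tens_add[OF tens_const k(1)]])
      also have "\<phi> (\<lambda>x. 1 + k x) = 1 + \<phi> k" using add[OF tens_const k(1)] one by metis
      finally show ?thesis .
    qed
    show "cnonneg (1 + \<phi> h)" by (rule shift[OF h])
    have "cnonneg (1 + \<phi> (\<lambda>x. qscale (-1) (h x)))"
      using h by (intro shift tens_scale) (simp_all add: qscale_simps qstar_simps)
    then show "cnonneg (1 - \<phi> h)" by (simp add: scale[OF h(1)])
  qed
  have r: "0 \<le> r" using g(2) norm_ge_zero order_trans by blast
  show ?thesis
  \<comment> \<open>The normalisation in the second case divides by r.\<close>
  proof (cases "r = 0")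
    case True
    then have "g = (\<lambda>x. qscale 0 (g x))" using g(2) by (simp add: qscale_zero fun_eq_iff)
    then have "\<phi> g = 0" using scale[OF g(1), of 0] by simp
    then show ?thesis using r by simp
  next
    case False
    then have r: "0 < r" using r by simp
    \<comment> \<open>\<open>a\<close> and \<open>b\<close> are the real and imaginary parts of g,
      rescaled: the sum and the difference of g and its star have norm at most 2r, and the factor
      1/(4r) brings this down to 1/2.\<close>
    define c :: complex where "c = of_real (1 / (4 * r))"
    define a where "a = (\<lambda>x. qscale c (g x + qstar (g x)))"
    define b where "b = (\<lambda>x. qscale (\<i> * c) (qstar (g x) + qscale (-1) (g x)))"
    have c: "cmod c = 1 / (4 * r)" "cnj c = c" using r by (simp_all add: c_def norm_divide)
    have a_tens: "a \<in> tens" and b_tens: "b \<in> tens"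
      unfolding a_def b_def by (intro tens_scale tens_add tens_star g(1))+
    have "norm (g x + qstar (g x)) \<le> 2 * r" "norm (qstar (g x) + qscale (-1) (g x)) \<le> 2 * r" for x
      using norm_triangle_ineq[of "g x" "qstar (g x)"] norm_triangle_ineq[of "qstar (g x)" "qscale (-1) (g x)"]
        g(2)[of x] by (simp_all add: qstar_simps qscale_simps)
    moreover have "norm (qscale d y) \<le> 1 / 2" if "cmod d = 1 / (4 * r)" "norm y \<le> 2 * r"
      for d and y :: "'h qloc"
      using mult_left_mono[OF that(2), of "1 / (4 * r)"] r that(1) by (simp add: qscale_simps(7))
    ultimately have norms: "norm (a x) \<le> 1 / 2" "norm (b x) \<le> 1 / 2" for x
      by (simp_all add: a_def b_def norm_mult c(1))
    have sa: "qstar (a x) = a x" "qstar (b x) = b x" for x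
      by (simp_all add: a_def b_def qstar_simps qscale_simps c add.commute)
    have "g = (\<lambda>x. qscale (of_real (2 * r)) (a x + qscale \<i> (b x)))"
    proof
      fix x
      have "a x + qscale \<i> (b x) = qscale (2 * c) (g x)"
        using qscale_simps(2)[of c c "g x"] qscale_simps(2)[of c "-c" "qstar (g x)"]
        by (simp add: a_def b_def qscale_simps mult.assoc[symmetric] qscale_zero add_ac)
      then show "g x = qscale (of_real (2 * r)) (a x + qscale \<i> (b x))"
        using r by (simp add: qscale_simps c_def)
    qed
    then have "\<phi> g = of_real (2 * r) * (\<phi> a + \<i> * \<phi> b)"
      using scale[OF tens_add[OF a_tens tens_scale[OF b_tens, of \<i>]], of "of_real (2 * r)"]
        add[OF a_tens tens_scale[OF b_tens, of \<i>]] scale[OF b_tens, of \<i>] by metis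
    then have "cmod (\<phi> g) = 2 * r * cmod (\<phi> a + \<i> * \<phi> b)" using r by (simp add: norm_mult)
    also have "cmod (\<phi> a + \<i> * \<phi> b) \<le> 1 + 1"
      by (intro order_trans[OF norm_triangle_ineq] add_mono)
         (simp_all add: norm_mult selfadjoint[OF a_tens norms(1) sa(1)] selfadjoint[OF b_tens norms(2) sa(2)])
    finally show ?thesis using r by simp
  qed
qed

lemma tens_pos_imp_qpos: "tens_pos g \<Longrightarrow> qpos (g x)"
  by (auto simp: tens_pos_def qpos_def)

lemma is_state_bound:
  fixes \<omega> :: "'h::finite qloc \<Rightarrow> complex"
  assumes "is_state \<omega>"
  shows "cmod (\<omega> b) \<le> 4 * norm b"
proof -
  \<comment> \<open>A state becomes a functional on \<open>tens\<close> by evaluating functions at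
    one arbitrary configuration; the alphabet \<open>bool\<close> is a placeholder.\<close>
  define \<phi> :: "(bool config \<Rightarrow> 'h qloc) \<Rightarrow> complex" where "\<phi> = (\<lambda>g. \<omega> (g undefined))"
  have "cmod (\<phi> (\<lambda>_. b)) \<le> 4 * norm b"
  proof (rule positive_functional_bound[of \<phi> "\<lambda>_. b" "norm b"])
    show "\<phi> (\<lambda>x. g x + h x) = \<phi> g + \<phi> h" for g h
      using assms by (simp add: \<phi>_def is_state_def qloc_ops)
    show "\<phi> (\<lambda>x. qscale c (g x)) = c * \<phi> g" for c g
      using assms by (simp add: \<phi>_def is_state_def)
    show "cnonneg (\<phi> g)" if "tens_pos g" for g
      using assms tens_pos_imp_qpos[OF that] by (simp add: \<phi>_def is_state_def)
    show "\<phi> (\<lambda>_. 1) = 1"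
      using assms by (simp add: \<phi>_def is_state_def qloc_ops)
  qed (simp_all add: tens_const)
  then show ?thesis by (simp add: \<phi>_def)
qed

section \<open>The correspondences\<close>

text \<open>At a fixed x the algebraic conditions on K are those of a state, so the passage from W
  to K merely exchanges the arguments; boundedness in x is the one point that requires
  proof.\<close>

lemma K_maps_iff:
  "K \<in> K_maps \<longleftrightarrow> (\<forall>b. K b \<in> Bfun) \<and> (\<forall>x. is_state (\<lambda>b. K b x))"
  by (auto simp: K_maps_def is_state_def fun_eq_iff)

lemma cq_channels_iff:
  fixes W :: "'a config \<Rightarrow> 'h::finite qloc \<Rightarrow> complex"
  shows "W \<in> cq_channels \<longleftrightarrow> W_to_K W \<in> K_maps"
proof
  assume W: "W \<in> cq_channels"
  then have "(\<lambda>x. W x b) \<in> Bfun" for b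
    unfolding Bfun_iff cq_channels_def using is_state_bound by blast
  with W show "W_to_K W \<in> K_maps" by (simp add: K_maps_iff W_to_K_def cq_channels_def)
qed (simp add: K_maps_iff W_to_K_def cq_channels_def Bfun_iff)

lemma bij_betw_W_to_K:
  "bij_betw (W_to_K :: ('a config \<Rightarrow> 'h::finite qloc \<Rightarrow> complex) \<Rightarrow> _) cq_channels K_maps"
  by (rule bij_betw_byWitness[where f' = "\<lambda>K x b. K b x"])
     (auto simp: cq_channels_iff image_subset_iff, simp_all add: W_to_K_def)

lemma K_maps_bound: "K \<in> K_maps \<Longrightarrow> cmod (K b x) \<le> 4 * norm b" for b :: "'h::finite qloc"
  using is_state_bound[of "\<lambda>b. K b x"] by (simp add: K_maps_iff)

lemma K_maps_simps:
  fixes a b :: "'h::finite qloc"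
  assumes "K \<in> K_maps"
  shows "K (a + b) x = K a x + K b x" "K (qscale c a) x = c * K a x" "K (a - b) x = K a x - K b x"
proof -
  show *: "K (a + b) x = K a x + K b x" "K (qscale c a) x = c * K a x" for a b c
    using assms by (simp_all add: K_maps_def plus_qloc_def)
  show "K (a - b) x = K a x - K b x"
    using *(1)[of a "- b"] *(2)[of "-1" b] by (simp add: qscale_minus_one)
qed

text \<open>The argument of K and the evaluation point vary together, so measurability is not
  immediate from that of each \<open>K b\<close>. For simple g the diagonal is a finite sum of
  products \<open>f x * K b x\<close>; in general it is a pointwise limit of these, because b
  \<mapsto> \<open>K b x\<close> is Lipschitz with constant 4 at every x.\<close>

lemma K_diagonal_Bfun:
  fixes K :: "'h::finite qloc \<Rightarrow> 'a config \<Rightarrow> complex"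
  assumes K: "K \<in> K_maps" and g: "g \<in> tens"
  shows "(\<lambda>x. K (g x) x) \<in> Bfun"
proof -
  have simple: "(\<lambda>x. K (s x) x) \<in> borel_measurable SigmaC" if "s \<in> simple" for s
    using that
  proof induction
    case simple_zero
    then show ?case using K by (simp add: K_maps_iff Bfun_iff)
  next
    case (simple_step s f b)
    have "K b \<in> borel_measurable SigmaC" "f \<in> borel_measurable SigmaC"
      using K simple_step(2) by (simp_all add: K_maps_iff Bfun_iff)
    with simple_step.IH show ?case
      unfolding K_maps_simps[OF K] by (intro borel_measurable_add borel_measurable_times)
  qed
  obtain S where S: "\<And>n. S n \<in> simple" "uniform_limit UNIV S g sequentially" using g tens_approx by blast
  have "(\<lambda>x. K (g x) x) \<in> borel_measurable SigmaC"
  proof (rule borel_measurable_LIMSEQ_metric[OF simple[OF S(1)]])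
    fix x
    have "(\<lambda>n. S n x - g x) \<longlonglongrightarrow> 0"
      using tendsto_uniform_limitI[OF S(2), of x] by (simp add: LIM_zero)
    then have lim: "(\<lambda>n. 4 * norm (S n x - g x)) \<longlonglongrightarrow> 0"
      using tendsto_mult_right_zero tendsto_norm_zero by blast
    have "(\<lambda>n. K (S n x) x - K (g x) x) \<longlonglongrightarrow> 0"
      by (rule Lim_null_comparison[OF _ lim]) (simp add: K_maps_bound[OF K] flip: K_maps_simps(3)[OF K])
    then show "(\<lambda>n. K (S n x) x) \<longlonglongrightarrow> K (g x) x" by (rule LIM_zero_cancel)
  qed
  moreover obtain B where "\<And>x. norm (g x) \<le> B" using tens_bounded[OF g] by blast
  then have "cmod (K (g x) x) \<le> 4 * B" for x
    using K_maps_bound[OF K, of "g x" x] by (smt (verit))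
  ultimately show ?thesis unfolding Bfun_iff by blast
qed

text \<open>Once the diagonal is known to be bounded and Borel, everything is pointwise; positivity
  holds because a positive element of \<open>tens\<close> has positive values.\<close>

lemma K_to_E_in_E_maps:
  fixes K :: "'h::finite qloc \<Rightarrow> 'a config \<Rightarrow> complex"
  assumes K: "K \<in> K_maps"
  shows "K_to_E K \<in> E_maps"
proof -
  have "K qone = (\<lambda>x. 1)" "\<And>a x. qpos a \<Longrightarrow> cnonneg (K a x)" using K by (auto simp: K_maps_def)
  then show ?thesis
    unfolding E_maps_def K_to_E_def
    by (auto simp: K_diagonal_Bfun[OF K] qloc_ops tens_add tens_scale tens_const tens_elementary
        tens_pos_imp_qpos K_maps_simps[OF K])
qed

text \<open>Restriction to constant functions, that is to the tensors 1 \<otimes> b, will be the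
  inverse of the correspondence. Positivity is inherited because the witness y of
  \<open>qpos\<close> can be used as a constant function in \<open>tens\<close>.\<close>

lemma E_maps_imp_K_maps:
  fixes E :: "('a config \<Rightarrow> 'h::finite qloc) \<Rightarrow> 'a config \<Rightarrow> complex"
  assumes E: "E \<in> E_maps"
  shows "(\<lambda>b. E (\<lambda>_. b)) \<in> K_maps"
proof -
  have pos: "cnonneg (E (\<lambda>_. a) x)" if "qpos a" for a x
  proof -
    from that obtain y where "a = qmult (qstar y) y" by (auto simp: qpos_def)
    then have "tens_pos ((\<lambda>_. a) :: 'a config \<Rightarrow> 'h qloc)"
      unfolding tens_pos_def by (intro bexI[OF _ tens_const[of y]]) simp
    then show ?thesis using E tens_const[of a] unfolding E_maps_def by blast
  qed
  have "E (\<lambda>_. qadd a b) = (\<lambda>x. E (\<lambda>_. a) x + E (\<lambda>_. b) x)" for a b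
  proof -
    have "\<forall>g\<in>tens. \<forall>h\<in>tens. E (\<lambda>x. qadd (g x) (h x)) = (\<lambda>x. E g x + E h x)"
      using E by (simp add: E_maps_def)
    from bspec[OF bspec[OF this tens_const] tens_const] show ?thesis .
  qed
  moreover have "E (\<lambda>_. qscale c a) = (\<lambda>x. c * E (\<lambda>_. a) x)" for c a
  proof -
    have "\<forall>g\<in>tens. E (\<lambda>x. qscale c (g x)) = (\<lambda>x. c * E g x)"
      using E by (simp add: E_maps_def)
    from bspec[OF this tens_const] show ?thesis .
  qed
  moreover have "E (\<lambda>_. b) \<in> Bfun" for b
  proof -
    have "\<forall>g\<in>tens. E g \<in> Bfun" using E by (simp add: E_maps_def)
    from bspec[OF this tens_const] show ?thesis .
  qed
  moreover have "E (\<lambda>_. qone) = (\<lambda>x. 1)" using E by (simp add: E_maps_def)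
  ultimately show ?thesis using pos by (simp add: K_maps_def)
qed

text \<open>E(g) at x sees only the value of g at x, which is the diagonal form of E. On simple
  functions this is the module property; both sides are continuous in g, and simple functions are
  uniformly dense in \<open>tens\<close>.\<close>

lemma E_maps_determined:
  fixes E :: "('a config \<Rightarrow> 'h::finite qloc) \<Rightarrow> 'a config \<Rightarrow> complex"
  assumes E: "E \<in> E_maps" and g: "g \<in> tens"
  shows "E g x = E (\<lambda>_. g x) x"
proof -
  define K where "K = (\<lambda>b. E (\<lambda>_. b))"
  have K: "K \<in> K_maps" unfolding K_def by (rule E_maps_imp_K_maps[OF E])
  have add: "E (\<lambda>x. g x + h x) x = E g x + E h x" if "g \<in> tens" "h \<in> tens" for g h x
    using E that by (simp add: E_maps_def plus_qloc_def)
  have scale: "E (\<lambda>x. qscale c (g x)) x = c * E g x" if "g \<in> tens" for c g x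
    using E that by (simp add: E_maps_def)
  have bound: "cmod (E h x) \<le> 4 * r" if "h \<in> tens" "\<And>x. norm (h x) \<le> r" for h x r
  proof (rule positive_functional_bound[of "\<lambda>g. E g x", OF add scale _ _ that])
    show "cnonneg (E g x)" if "g \<in> tens" "tens_pos g" for g using E that by (simp add: E_maps_def)
    show "E (\<lambda>_. 1) x = 1" using E by (simp add: E_maps_def one_qloc_def)
  qed
  have simple: "E s x = K (s x) x" if "s \<in> simple" for s x
    using that
  proof (induction arbitrary: x)
    case (simple_step s f b)
    have "E (\<lambda>x. qscale (f x) b) x = f x * K b x"
      using E simple_step(2) by (simp add: E_maps_def K_def)
    then show ?case
      using add[OF simple_imp_tens[OF simple_step(1)] tens_elementary[OF simple_step(2)]] simple_step.IH
      by (simp add: K_maps_simps[OF K])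
  qed (simp add: K_def)
  \<comment> \<open>Each of the two terms moves by at most 4e when g is replaced by a simple
    function within e of it.\<close>
  have le: "cmod (E g x - K (g x) x) \<le> 8 * e" if e: "0 < e" for e
  proof -
    obtain s where s: "s \<in> simple" "\<And>x. norm (g x - s x) \<le> e" using g e by (metis tens_iff)
    have diff: "(\<lambda>x. g x - s x) \<in> tens"
      using tens_add[OF g tens_scale[OF simple_imp_tens[OF s(1)], of "-1"]] by (simp add: qscale_minus_one)
    have "E g x = E s x + E (\<lambda>x. g x - s x) x"
      using add[OF simple_imp_tens[OF s(1)] diff] by simp
    then have "E g x - K (g x) x = E (\<lambda>x. g x - s x) x - K (g x - s x) x"
      by (simp add: simple[OF s(1)] K_maps_simps[OF K])
    also have "cmod \<dots> \<le> 4 * e + 4 * e"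
    proof (intro order_trans[OF norm_triangle_ineq4] add_mono)
      show "cmod (E (\<lambda>x. g x - s x) x) \<le> 4 * e" by (rule bound[OF diff s(2)])
      show "cmod (K (g x - s x) x) \<le> 4 * e"
        using K_maps_bound[OF K, of "g x - s x" x] s(2)[of x] by simp
    qed
    finally show ?thesis by simp
  qed
  have "cmod (E g x - K (g x) x) \<le> 0"
    by (rule field_le_epsilon) (use le[of "e / 8" for e] in \<open>auto\<close>)
  then show ?thesis by (simp add: K_def)
qed

lemma bij_betw_K_to_E:
  "bij_betw (K_to_E :: ('h::finite qloc \<Rightarrow> 'a config \<Rightarrow> complex) \<Rightarrow> _) K_maps E_maps"
proof (rule bij_betw_byWitness[where f' = "\<lambda>E b. E (\<lambda>_. b)"])
  show "\<forall>K\<in>K_maps. (\<lambda>b. K_to_E K (\<lambda>_. b)) = (K :: 'h qloc \<Rightarrow> 'a config \<Rightarrow> complex)"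
    by (simp add: K_to_E_def tens_const)
  show "\<forall>E\<in>E_maps. K_to_E (\<lambda>b. E (\<lambda>_. b)) = (E :: ('a config \<Rightarrow> 'h qloc) \<Rightarrow> 'a config \<Rightarrow> complex)"
  proof (intro ballI ext)
    fix E :: "('a config \<Rightarrow> 'h qloc) \<Rightarrow> 'a config \<Rightarrow> complex" and g x
    assume E: "E \<in> E_maps"
    show "K_to_E (\<lambda>b. E (\<lambda>_. b)) g x = E g x"
    proof (cases "g \<in> tens")
      case True
      then show ?thesis by (simp add: K_to_E_def E_maps_determined[OF E True])
    next
      \<comment> \<open>Off \<open>tens\<close> both sides take the default value 0; this convention
        in \<open>E_maps\<close> makes E recoverable from K as a total function.\<close>
      case False
      then show ?thesis using E by (simp add: K_to_E_def E_maps_def)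
    qed
  qed
qed (auto simp: K_to_E_in_E_maps E_maps_imp_K_maps)

theorem theorem1:
  shows "bij_betw (W_to_K :: ('a::finite config \<Rightarrow> 'h::finite qloc \<Rightarrow> complex) \<Rightarrow> _)
            cq_channels K_maps
       \<and> bij_betw (K_to_E :: ('h::finite qloc \<Rightarrow> 'a::finite config \<Rightarrow> complex) \<Rightarrow> _)
            K_maps E_maps
       \<and> (\<forall>W1\<in>(cq_channels :: ('a config \<Rightarrow> 'h qloc \<Rightarrow> complex) set). \<forall>W2\<in>cq_channels.
            \<forall>t::real. 0 \<le> t \<and> t \<le> 1 \<longrightarrow>
              W_to_K (\<lambda>x b. of_real t * W1 x b + (1 - of_real t) * W2 x b)
              = (\<lambda>b x. of_real t * W_to_K W1 b x + (1 - of_real t) * W_to_K W2 b x))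
       \<and> (\<forall>K1\<in>(K_maps :: ('h qloc \<Rightarrow> 'a config \<Rightarrow> complex) set). \<forall>K2\<in>K_maps.
            \<forall>t::real. 0 \<le> t \<and> t \<le> 1 \<longrightarrow>
              K_to_E (\<lambda>b x. of_real t * K1 b x + (1 - of_real t) * K2 b x)
              = (\<lambda>g x. of_real t * K_to_E K1 g x + (1 - of_real t) * K_to_E K2 g x))"
  \<comment> \<open>Both affine identities are pointwise; off \<open>tens\<close>, where
    \<open>K_to_E\<close> has the value 0, the convex combination is 0 as well.\<close>
  by (simp add: bij_betw_W_to_K bij_betw_K_to_E W_to_K_def K_to_E_def fun_eq_iff)

end
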